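(* Let $X\subset\mathbb R^2$, $Y=(a,b)$, $c$, $L_x(y)$, $P$, the notion "splits the mass" and the MCP be as in the context. Let $\mu$ and $\nu$ be Borel probability measures on $X$ and $Y$ that are absolutely continuous with respect to Lebesgue measure, and let $\gamma$ be a solution of the Kantorovich problem with cost $c$ and marginals $\mu,\nu$. Suppose that for all $(x,y)\in\overline X\times\overline Y$ such that $y$ splits the mass at $x$ there exists an $\tilde x\in P\cap L_x(y)$ satisfying the MCP. Then for each $x\in\overline X$ there is a unique $y\in\overline Y$ that splits the mass at $x$. Moreover, $(x,y)\in spt(\gamma)$, and $(x,\overline y)\notin spt(\gamma)$ for all other $\overline y\in\overline Y$. Therefore, the optimal map is well defined everywhere.
   Context: $Y=(a,b)\subset\mathbb R$ is an open interval and $X$ is a bounded domain in $\mathbb R^2$; the closures $\overline X$, $\overline Y$ are compact. The cost $c\in C^2(\overline X\times\overline Y)$ is such that the gradient $\nabla_x\big(\frac{\partial c}{\partial y}\big)(x,y)$ does not vanish for any $x\in X$, $y\in Y$. The level set through $x$ is $L_x(y):=\{\overline x\in X:\frac{\partial c(\overline x,y)}{\partial y}=\frac{\partial c(x,y)}{\partial y}\}$; the same formula is used when $x$ or $y$ is a point of $\overline X$ or $\overline Y$. $P$ is the set of $\tilde x\in\overline X$ such that for all $y_0<y_1$ in $Y$ and all $x\in L_{\tilde x}(y_0)$ we have $\frac{\partial c(\tilde x,y_1)}{\partial y}\le\frac{\partial c(x,y_1)}{\partial y}$. $y$ splits the mass at $x$ if $\mu\big(\{\overline x:\frac{\partial c(x,y)}{\partial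 y}<\frac{\partial c(\overline x,y)}{\partial y}\}\big)=\nu([a,y))$. $\tilde x\in P$ satisfies the mass comparison property (MCP) if for all $y_0<y_1$ in $Y$, $\mu\big(\bigcup_{y\in[y_0,y_1]}L_{\tilde x}(y)\big)<\nu([y_0,y_1])$. The Kantorovich problem is to minimize $\int_{X\times Y}c\,d\gamma$ over Borel probability measures $\gamma$ on $X\times Y$ with marginals $\mu$ and $\nu$. $spt(\gamma)$ is the smallest closed subset of $X\times Y$ of full $\gamma$-mass. The optimal map is the Borel map $F:X\to Y$ pushing $\mu$ forward to $\nu$ that minimizes $\int_X c(x,F(x))\,d\mu$.
   Formalization: Two hypotheses are added, since the claim fails without them: the support of μ is all of the closure of X, and the gradient of ∂c/∂y in x is nonzero for x in X and all y in the closed interval [a,b], not only in (a,b). *)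

theory Defs
  imports "HOL-Probability.Probability"
begin

text \<open>Throughout, \<open>X\<close> is a subset of the plane and \<open>Y = {a<..<b}\<close>, with closure \<open>{a..b}\<close>.
  The cost \<open>c\<close> is a total function whose values matter only on \<open>closure X \<times> {a..b}\<close>.\<close>

definition C2_up_to_closure :: "('a::real_normed_vector \<Rightarrow> real) \<Rightarrow> 'a set \<Rightarrow> bool" where
  \<comment> \<open>\<open>f\<close> is twice differentiable on the open set \<open>S\<close>, and \<open>f\<close> and its derivatives up to order two
     extend continuously to \<open>closure S\<close>; on the boundary \<open>D1\<close> and \<open>D2\<close> are these extensions.\<close>
  "C2_up_to_closure f S \<longleftrightarrow>
     continuous_on (closure S) f \<and>
     (\<exists>(D1 :: 'a \<Rightarrow> ('a \<Rightarrow>\<^sub>L real)) (D2 :: 'a \<Rightarrow> ('a \<Rightarrow>\<^sub>L ('a \<Rightarrow>\<^sub>L real))).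
        continuous_on (closure S) D1 \<and> continuous_on (closure S) D2 \<and>
        (\<forall>z\<in>S. (f has_derivative blinfun_apply (D1 z)) (at z)) \<and>
        (\<forall>z\<in>S. (D1 has_derivative blinfun_apply (D2 z)) (at z)))"

definition cost_dy :: "(real^2 \<Rightarrow> real \<Rightarrow> real) \<Rightarrow> real \<Rightarrow> real \<Rightarrow> real^2 \<Rightarrow> real \<Rightarrow> real" where
  \<comment> \<open>The partial derivative of \<open>c\<close> in \<open>y\<close>, one-sided at the end points. For a cost that is
     \<open>C\<^sup>2\<close> up to the closure it exists also for \<open>x\<close> on the boundary of \<open>X\<close>, where it is the
     continuous extension of the partial derivative in the interior.\<close>
  "cost_dy c a b x y = vector_derivative (c x) (at y within {a..b})"

definition level_set ::
  "(real^2 \<Rightarrow> real \<Rightarrow> real) \<Rightarrow> (real^2) set \<Rightarrow> real \<Rightarrow> real \<Rightarrow> real^2 \<Rightarrow> real \<Rightarrow> (real^2) set" where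
  \<comment> \<open>Boundary points of \<open>X\<close> belong to the level sets. Within \<open>X\<close> alone, the level set through
     a maximum point over \<open>closure X\<close> of \<open>\<lambda>x. cost_dy c a b x a\<close> would be empty, as its
     gradient does not vanish in \<open>X\<close>.\<close>
  "level_set c X a b x y = {x' \<in> closure X. cost_dy c a b x' y = cost_dy c a b x y}"

definition set_P ::
  "(real^2 \<Rightarrow> real \<Rightarrow> real) \<Rightarrow> (real^2) set \<Rightarrow> real \<Rightarrow> real \<Rightarrow> (real^2) set" where
  "set_P c X a b = {x' \<in> closure X.
     \<forall>y0\<in>{a<..<b}. \<forall>y1\<in>{a<..<b}. y0 < y1 \<longrightarrow>
       (\<forall>x\<in>level_set c X a b x' y0. cost_dy c a b x' y1 \<le> cost_dy c a b x y1)}"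

definition borel_prob_on :: "'a::topological_space set \<Rightarrow> 'a measure \<Rightarrow> bool" where
  \<comment> \<open>A Borel probability measure on \<open>S\<close>, as a Borel measure on the ambient space concentrated
     on \<open>S\<close>.\<close>
  "borel_prob_on S M \<longleftrightarrow> prob_space M \<and> sets M = sets borel \<and> S \<in> sets borel \<and> emeasure M S = 1"

definition splits_mass ::
  "(real^2 \<Rightarrow> real \<Rightarrow> real) \<Rightarrow> (real^2) set \<Rightarrow> real \<Rightarrow> real \<Rightarrow> (real^2) measure \<Rightarrow> real measure
    \<Rightarrow> real^2 \<Rightarrow> real \<Rightarrow> bool" where
  "splits_mass c X a b \<mu> \<nu> x y \<longleftrightarrow>
     measure \<mu> {x' \<in> X. cost_dy c a b x y < cost_dy c a b x' y} = measure \<nu> {a..<y}"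

definition mass_comparison ::
  "(real^2 \<Rightarrow> real \<Rightarrow> real) \<Rightarrow> (real^2) set \<Rightarrow> real \<Rightarrow> real \<Rightarrow> (real^2) measure \<Rightarrow> real measure
    \<Rightarrow> real^2 \<Rightarrow> bool" where
  "mass_comparison c X a b \<mu> \<nu> x \<longleftrightarrow>
     (\<forall>y0\<in>{a<..<b}. \<forall>y1\<in>{a<..<b}. y0 < y1 \<longrightarrow>
        measure \<mu> (\<Union>y\<in>{y0..y1}. level_set c X a b x y) < measure \<nu> {y0..y1})"

definition spt :: "'a::topological_space measure \<Rightarrow> 'a set" where
  \<comment> \<open>The closed sets are those of the ambient space, so that the support of a measure on
     \<open>S\<close> is a subset of \<open>closure S\<close>.\<close>
  "spt M = \<Inter>{C. closed C \<and> emeasure M (- C) = 0}"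

definition couplings ::
  "(real^2) measure \<Rightarrow> real measure \<Rightarrow> ((real^2) \<times> real) measure set" where
  \<comment> \<open>If \<open>\<mu>\<close> and \<open>\<nu>\<close> are concentrated on \<open>X\<close> and \<open>Y\<close>, the marginal conditions force
     \<open>\<gamma>\<close> to be concentrated on \<open>X \<times> Y\<close>.\<close>
  "couplings \<mu> \<nu> = {\<gamma>. prob_space \<gamma> \<and> sets \<gamma> = sets borel \<and>
     distr \<gamma> borel fst = \<mu> \<and> distr \<gamma> borel snd = \<nu>}"

definition kantorovich_cost ::
  "(real^2 \<Rightarrow> real \<Rightarrow> real) \<Rightarrow> (real^2) set \<Rightarrow> real \<Rightarrow> real \<Rightarrow> ((real^2) \<times> real) measure \<Rightarrow> real" where
  "kantorovich_cost c X a b \<gamma> = (LINT z:X \<times> {a<..<b}|\<gamma>. c (fst z) (snd z))"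

definition kantorovich_solution ::
  "(real^2 \<Rightarrow> real \<Rightarrow> real) \<Rightarrow> (real^2) set \<Rightarrow> real \<Rightarrow> real \<Rightarrow> (real^2) measure \<Rightarrow> real measure
    \<Rightarrow> ((real^2) \<times> real) measure \<Rightarrow> bool" where
  "kantorovich_solution c X a b \<mu> \<nu> \<gamma> \<longleftrightarrow>
     \<gamma> \<in> couplings \<mu> \<nu> \<and>
     (\<forall>\<gamma>'\<in>couplings \<mu> \<nu>. kantorovich_cost c X a b \<gamma> \<le> kantorovich_cost c X a b \<gamma>')"

definition transport_map ::
  "(real^2) set \<Rightarrow> real \<Rightarrow> real \<Rightarrow> (real^2) measure \<Rightarrow> real measure \<Rightarrow> (real^2 \<Rightarrow> real) \<Rightarrow> bool" where
  "transport_map X a b \<mu> \<nu> F \<longleftrightarrow>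
     F \<in> borel_measurable (restrict_space borel X) \<and> F ` X \<subseteq> {a<..<b} \<and>
     distr (restrict_space \<mu> X) borel F = \<nu>"

definition optimal_map ::
  "(real^2 \<Rightarrow> real \<Rightarrow> real) \<Rightarrow> (real^2) set \<Rightarrow> real \<Rightarrow> real \<Rightarrow> (real^2) measure \<Rightarrow> real measure
    \<Rightarrow> (real^2 \<Rightarrow> real) \<Rightarrow> bool" where
  "optimal_map c X a b \<mu> \<nu> F \<longleftrightarrow>
     transport_map X a b \<mu> \<nu> F \<and>
     (\<forall>G. transport_map X a b \<mu> \<nu> G \<longrightarrow>
        (LINT x:X|\<mu>. c x (F x)) \<le> (LINT x:X|\<mu>. c x (G x)))"

end

theory Submission
  imports Defs
begin

text \<open>Write \<open>s = \<partial>c/\<partial>y\<close> and let \<open>\<phi>\<^sub>x(y)\<close> be the \<open>\<mu>\<close>-mass of \<open>{s(\<cdot>,y) > s(x,y)}\<close> minus \<open>\<nu>[a,y)\<close>. Level sets of \<open>s\<close> are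
  null, so \<open>\<phi>\<close> is continuous, and it is nonnegative at \<open>a\<close> and nonpositive at \<open>b\<close>; its zeros are the
  splitting points. The mass comparison property of a point \<open>p\<close> makes \<open>\<phi>\<^sub>p\<close> strictly decreasing. If \<open>y\<close>
  in the interior splits at \<open>x\<close>, with \<open>p \<in> P\<close> on the same level, then \<open>s(p,y') \<le> s(x,y')\<close> and so
  \<open>\<phi>\<^sub>x(y') \<le> \<phi>\<^sub>p(y') < 0\<close> for \<open>y' > y\<close>. Splitting at \<open>y = a\<close>, possible only for boundary points, needs a
  separate limiting argument.

  Let \<open>F(x)\<close> be the unique zero of \<open>\<phi>\<^sub>x\<close> and \<open>k(y)\<close> the value of \<open>s(\<cdot>,y)\<close> on the splitting level. Then
  \<open>s(x,y) < k(y)\<close> iff \<open>y < F(x)\<close>, and likewise with both signs reversed. Hence \<open>F\<close> pushes \<open>\<mu>\<close> to \<open>\<nu>\<close>, and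
  for a primitive \<open>v\<close> of \<open>k\<close> the function \<open>c(x,\<cdot>) - v\<close> has its strict minimum at \<open>F(x)\<close>. By duality a coupling
  is optimal iff it is concentrated on the graph of the continuous function \<open>F\<close>.\<close>

section \<open>Level sets of functions without critical points\<close>

lemma null_setsI_disjoint_translates:
  fixes E :: "'a::euclidean_space set"
  assumes "bounded E" "E \<in> sets borel"
    and dir: "\<And>x. x \<in> E \<Longrightarrow> \<exists>v\<in>V. \<exists>\<delta>>0. \<forall>t. 0 < t \<and> t < \<delta> \<longrightarrow> x + t *\<^sub>R v \<notin> E"
    and "countable V"
  shows "E \<in> null_sets lborel"
proof -
  \<comment> \<open>The translates of \<open>G n v\<close> by rational multiples of \<open>v\<close> shorter than \<open>1 / (n + 1)\<close> are disjoint
     and lie in a bounded set, so infinitely many sets of equal measure fit into finite volume.\<close>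
  define G where "G n v = {x\<in>E. \<forall>q::rat. 0 < q \<and> q < 1 / of_nat (Suc n) \<longrightarrow> x + of_rat q *\<^sub>R v \<notin> E}"
    for n :: nat and v :: 'a
  have G_borel: "G n v \<in> sets borel" for n v
  proof -
    have "G n v = E - (\<Union>q\<in>{q::rat. 0 < q \<and> q < 1 / of_nat (Suc n)}. (\<lambda>x. x + of_rat q *\<^sub>R v) -` E)"
      by (auto simp: G_def)
    moreover have "(\<lambda>x. x + of_rat q *\<^sub>R v) -` E \<in> sets borel" for q :: rat
      using measurable_sets[OF _ assms(2), of "\<lambda>x. x + of_rat q *\<^sub>R v" borel] by simp
    ultimately show ?thesis
      using assms(2) by (auto intro!: sets.countable_UN'')
  qed
  have "G n v \<in> null_sets lborel" for n v
  proof -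
    \<comment> \<open>Strictly decreasing rationals in (0, 1/(n+1)), so the difference of two of
      them is again a shift excluded by \<open>G\<close>. The offset j + 2 keeps even the first one
      strictly below the bound.\<close>
    define r' :: "nat \<Rightarrow> rat" where "r' j = 1 / (of_nat (Suc n) * of_nat (j + 2))" for j :: nat
    define A where "A j = (\<lambda>x. x + of_rat (r' j) *\<^sub>R v) ` G n v" for j
    have r'_pos: "0 < r' j" for j by (simp add: r'_def)
    have r'_less: "r' j < 1 / of_nat (Suc n)" for j
      by (simp add: r'_def divide_simps del: of_nat_Suc)
    have r'_strict: "r' j < r' i" if "i < j" for i j
      using that unfolding r'_def by (simp add: divide_simps)
    have A_eq: "A j = (\<lambda>x. - (of_rat (r' j) *\<^sub>R v) + x) -` G n v" for j
      unfolding A_def by (force simp: image_iff algebra_simps)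
    have A_borel: "A j \<in> sets borel" for j
    proof -
      have "(+) (- (of_rat (r' j) *\<^sub>R v)) -` G n v \<inter> space borel \<in> sets borel"
        by (rule measurable_sets[OF _ G_borel]) simp
      then show ?thesis by (simp only: A_eq space_borel Int_UNIV_right)
    qed
    have A_meas: "emeasure lborel (A j) = emeasure lborel (G n v)" for j
    proof -
      have "emeasure lborel (G n v) = emeasure (distr lborel borel ((+) (- (of_rat (r' j) *\<^sub>R v)))) (G n v)"
        by (simp add: lborel_distr_plus)
      also have "\<dots> = emeasure lborel (A j)"
        unfolding A_eq by (subst emeasure_distr) (simp_all add: G_borel)
      finally show ?thesis by simp
    qed
    have disj': "A i \<inter> A j = {}" if "i < j" for i j
    proof (rule ccontr)
      assume "A i \<inter> A j \<noteq> {}"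
      then obtain x x' where x: "x \<in> G n v" "x' \<in> G n v" "x + of_rat (r' i) *\<^sub>R v = x' + of_rat (r' j) *\<^sub>R v"
        unfolding A_def by blast
      then have "x' = x + of_rat (r' i - r' j) *\<^sub>R v"
        by (simp add: of_rat_diff algebra_simps)
      moreover have "0 < r' i - r' j" "r' i - r' j < 1 / of_nat (Suc n)"
        using r'_strict[OF that] r'_less[of i] r'_pos[of j] by auto
      ultimately show False using x(1,2) unfolding G_def by auto
    qed
    have disj: "disjoint_family A"
      unfolding disjoint_family_on_def using disj' by (metis Int_commute linorder_neqE_nat)
    obtain R where R: "\<And>x. x \<in> E \<Longrightarrow> norm x \<le> R"
      using assms(1) unfolding bounded_iff by blast
    have "(\<Union>j. A j) \<subseteq> cball 0 (R + norm v)"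
    proof
      fix z assume "z \<in> (\<Union>j. A j)"
      then obtain j x where z: "z = x + of_rat (r' j) *\<^sub>R v" "x \<in> E"
        by (auto simp: A_def G_def)
      have "r' j \<le> 1" using r'_less[of j] by (rule less_imp_le[THEN order_trans]) simp
      then have "(of_rat (r' j) :: real) \<le> 1" by (simp add: of_rat_le_1_iff)
      then have "norm (of_rat (r' j) *\<^sub>R v) \<le> norm v"
        using r'_pos[of j] by (simp add: mult_left_le_one_le)
      then show "z \<in> cball 0 (R + norm v)"
        using R[OF z(2)] norm_triangle_ineq[of x "of_rat (r' j) *\<^sub>R v"] by (simp add: z(1))
    qed
    then have "emeasure lborel (\<Union>j. A j) \<le> emeasure lborel (cball (0::'a) (R + norm v))"
      by (intro emeasure_mono) auto
    also have "\<dots> < \<infinity>" by (rule emeasure_lborel_cball_finite)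
    finally have "(\<lambda>j. measure lborel (A j)) sums measure lborel (\<Union>j. A j)"
      using A_borel disj by (intro measure_UNION) auto
    then have "(\<lambda>j. measure lborel (A j)) \<longlonglongrightarrow> 0"
      by (intro summable_LIMSEQ_zero) (auto simp: sums_iff)
    then have "(\<lambda>j::nat. measure lborel (G n v)) \<longlonglongrightarrow> 0"
      by (simp add: A_meas measure_def)
    then have "measure lborel (G n v) = 0"
      using LIMSEQ_unique tendsto_const by blast
    moreover have "emeasure lborel (G n v) < \<infinity>"
    proof -
      have "emeasure lborel (G n v) \<le> emeasure lborel (cball (0::'a) R)"
        using R by (intro emeasure_mono) (auto simp: G_def)
      also have "\<dots> < \<infinity>" by (rule emeasure_lborel_cball_finite)
      finally show ?thesis .
    qed
    ultimately show ?thesis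
      using G_borel by (auto simp: null_sets_def emeasure_eq_ennreal_measure)
  qed
  then have "(\<Union>v\<in>V. \<Union>n. G n v) \<in> null_sets lborel"
    using assms(4) by (intro null_sets_UN' ) auto
  moreover have "E \<subseteq> (\<Union>v\<in>V. \<Union>n. G n v)"
  proof
    fix x assume "x \<in> E"
    then obtain v \<delta> where v: "v \<in> V" "\<delta> > 0" "\<And>t. 0 < t \<Longrightarrow> t < \<delta> \<Longrightarrow> x + t *\<^sub>R v \<notin> E"
      using dir by blast
    obtain n where n: "1 / real (Suc n) < \<delta>"
      using v(2) nat_approx_posE by blast
    have "x + of_rat q *\<^sub>R v \<notin> E" if "0 < q" "q < 1 / of_nat (Suc n)" for q :: rat
    proof (rule v(3))
      show "0 < real_of_rat q" using that by simp
      have "real_of_rat q < real_of_rat (1 / of_nat (Suc n))" using that(2) by (simp only: of_rat_less)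
      also have "\<dots> < \<delta>" using n by (simp add: of_rat_divide del: of_nat_Suc)
      finally show "real_of_rat q < \<delta>" .
    qed
    then have "x \<in> G n v" using \<open>x \<in> E\<close> unfolding G_def by blast
    then show "x \<in> (\<Union>v\<in>V. \<Union>n. G n v)" using v(1) by blast
  qed
  ultimately show ?thesis
    using assms(2) null_sets_subset[of _ lborel E] by auto
qed

lemma gderiv_pos_direction:
  fixes g :: "'a::real_inner \<Rightarrow> real"
  assumes "GDERIV g x :> D" "0 < D \<bullet> v"
  shows "\<exists>\<delta>>0. \<forall>t. 0 < t \<and> t < \<delta> \<longrightarrow> g x < g (x + t *\<^sub>R v)"
proof -
  have "(g has_derivative (\<lambda>h. h \<bullet> D)) (at (x + 0 *\<^sub>R v))"
    using assms(1) by (simp add: gderiv_def)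
  then have "((\<lambda>t. g (x + t *\<^sub>R v)) has_derivative (\<lambda>t. (t *\<^sub>R v) \<bullet> D)) (at 0)"
    by (rule has_derivative_compose[rotated]) (auto intro!: derivative_eq_intros)
  then have "DERIV (\<lambda>t. g (x + t *\<^sub>R v)) 0 :> D \<bullet> v"
    by (simp add: has_field_derivative_def inner_commute mult_commute_abs)
  from DERIV_pos_inc_right[OF this assms(2)] show ?thesis by auto
qed

lemma gderiv_nonzero_not_extremal:
  fixes g :: "'a::real_inner \<Rightarrow> real"
  assumes "open X" "x \<in> X" "GDERIV g x :> D" "D \<noteq> 0"
  shows "\<exists>z\<in>X. g x < g z" "\<exists>z\<in>X. g z < g x"
proof -
  have *: "\<exists>z\<in>X. h x < h z" if h: "GDERIV h x :> E" "E \<noteq> 0" for h :: "'a \<Rightarrow> real" and E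
  proof -
    from gderiv_pos_direction[OF h(1), of E] h(2) obtain \<delta> where \<delta>: "\<delta> > 0"
      "\<And>t. 0 < t \<Longrightarrow> t < \<delta> \<Longrightarrow> h x < h (x + t *\<^sub>R E)" by auto
    obtain e where e: "e > 0" "ball x e \<subseteq> X" using assms(1,2) openE by blast
    \<comment> \<open>Short enough for the increase guaranteed below \<delta> and for the step to
      stay in the ball inside \<open>X\<close>.\<close>
    define t where "t = min (\<delta> / 2) (e / (2 * norm E))"
    have t: "0 < t" "t < \<delta>" using \<delta>(1) e(1) h(2) by (auto simp: t_def)
    have "t * norm E \<le> e / (2 * norm E) * norm E" by (rule mult_right_mono) (auto simp: t_def)
    also have "\<dots> < e" using e(1) h(2) by simp
    finally have "x + t *\<^sub>R E \<in> ball x e" using t(1) by (simp add: dist_norm)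
    then show ?thesis using e(2) \<delta>(2)[OF t] by blast
  qed
  show "\<exists>z\<in>X. g x < g z" using *[OF assms(3,4)] .
  have "GDERIV (\<lambda>x. - g x) x :> - D" using assms(3) by (rule GDERIV_minus)
  from *[OF this] assms(4) show "\<exists>z\<in>X. g z < g x" by simp
qed

text \<open>The gradient is known only pointwise, so a translation argument takes the place of the
  implicit function theorem. At each point some signed coordinate direction has positive slope; a
  short move along it strictly increases \<open>g\<close> and leaves the level. Restricting to
  coordinate directions keeps the set of directions finite.\<close>

lemma level_set_null:
  fixes g :: "'a::euclidean_space \<Rightarrow> real"
  assumes "open X" "bounded X" and g: "\<And>x. x \<in> X \<Longrightarrow> \<exists>D. (GDERIV g x :> D) \<and> D \<noteq> 0"
  shows "{x\<in>X. g x = t} \<in> null_sets lborel"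
proof (rule null_setsI_disjoint_translates)
  show "bounded {x\<in>X. g x = t}" using assms(2) by (rule bounded_subset) auto
  have "continuous_on X g"
    using g by (intro continuous_at_imp_continuous_on ballI)
      (auto simp: gderiv_def dest: has_derivative_continuous)
  then have "openin (top_of_set X) (X - {x\<in>X. g x = t})"
    using continuous_closedin_preimage_constant[of X g t] by (simp add: closedin_def Collect_conj_eq)
  then have "open (X - {x\<in>X. g x = t})"
    using assms(1) openin_open_trans by blast
  then have "X - (X - {x\<in>X. g x = t}) \<in> sets borel"
    using assms(1) by (intro sets.Diff borel_open)
  moreover have "X - (X - {x\<in>X. g x = t}) = {x\<in>X. g x = t}" by blast
  ultimately show "{x\<in>X. g x = t} \<in> sets borel" by (simp only:)
  show "countable (Basis \<union> uminus ` Basis :: 'a set)" by (simp add: countable_finite)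
  fix x assume "x \<in> {x\<in>X. g x = t}"
  then have x: "x \<in> X" "g x = t" by auto
  obtain D where D: "GDERIV g x :> D" "D \<noteq> 0" using g x(1) by blast
  obtain b where b: "b \<in> Basis" "D \<bullet> b \<noteq> 0" using D(2) euclidean_all_zero_iff by blast
  define v where "v = (if 0 < D \<bullet> b then b else - b)"
  have v: "v \<in> Basis \<union> uminus ` Basis" "0 < D \<bullet> v"
    using b by (auto simp: v_def)
  from gderiv_pos_direction[OF D(1) v(2)] obtain \<delta> where \<delta>:
    "\<delta> > 0" "\<And>s. 0 < s \<Longrightarrow> s < \<delta> \<Longrightarrow> g x < g (x + s *\<^sub>R v)" by auto
  have "x + s *\<^sub>R v \<notin> {x\<in>X. g x = t}" if "0 < s" "s < \<delta>" for s
    using \<delta>(2)[OF that] x(2) by simp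
  then show "\<exists>v\<in>Basis \<union> uminus ` Basis. \<exists>\<delta>>0. \<forall>s. 0 < s \<and> s < \<delta> \<longrightarrow> x + s *\<^sub>R v \<notin> {x\<in>X. g x = t}"
    using v(1) \<delta>(1) by blast
qed

section \<open>Regularity of the cost up to the boundary\<close>

text \<open>On \<open>X\<close> the fundamental theorem of calculus writes c(x,t) - c(x,a) as the
  integral of e(x,.). Both sides are continuous in x, so the identity persists on the closure, where
  differentiating the integral gives the one-sided derivative at the end points as well.\<close>

lemma has_derivative_at_closure:
  fixes X :: "'a::euclidean_space set" and c :: "'a \<Rightarrow> real \<Rightarrow> real"
  assumes ab: "a < b"
    and cont_c: "continuous_on (closure X \<times> {a..b}) (\<lambda>(x, y). c x y)"
    and cont_e: "continuous_on (closure X \<times> {a..b}) (\<lambda>(x, y). e x y)"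
    and deriv: "\<And>x y. x \<in> X \<Longrightarrow> y \<in> {a<..<b} \<Longrightarrow> (c x has_real_derivative e x y) (at y)"
    and x: "x \<in> closure X" and y: "y \<in> {a..b}"
  shows "(c x has_real_derivative e x y) (at y within {a..b})"
proof -
  have cont_cx: "continuous_on {a..b} (c x)" if "x \<in> closure X" for x
    using continuous_on_compose2[OF cont_c, of "{a..b}" "\<lambda>y. (x, y)"] that
    by (fastforce intro!: continuous_intros)
  have cont_ex: "continuous_on {a..b} (e x)" if "x \<in> closure X" for x
    using continuous_on_compose2[OF cont_e, of "{a..b}" "\<lambda>y. (x, y)"] that
    by (fastforce intro!: continuous_intros)
  have repr: "c x t = c x a + integral {a..t} (e x)" if t: "t \<in> {a..b}" for t
  proof -
    have inner: "c z t - c z a - integral {a..t} (e z) = 0" if z: "z \<in> X" for z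
    proof -
      have zc: "z \<in> closure X" using z closure_subset by blast
      have "(e z has_integral (c z t - c z a)) {a..t}"
      proof (rule fundamental_theorem_of_calculus_interior)
        show "a \<le> t" using t by simp
        show "continuous_on {a..t} (c z)"
          using t by (intro continuous_on_subset[OF cont_cx[OF zc]]) auto
        show "(c z has_vector_derivative e z u) (at u)" if "u \<in> {a<..<t}" for u
          using deriv[OF z, of u] that t by (simp add: has_real_derivative_iff_has_vector_derivative)
      qed
      then show ?thesis by (simp add: integral_unique)
    qed
    have "continuous_on (closure X) (\<lambda>z. c z t - c z a - integral (cbox a t) (e z))"
    proof (intro continuous_on_diff)
      show "continuous_on (closure X) (\<lambda>z. c z t)" "continuous_on (closure X) (\<lambda>z. c z a)"
        using continuous_on_compose2[OF cont_c, of "closure X" "\<lambda>z. (z, t)"] t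
          continuous_on_compose2[OF cont_c, of "closure X" "\<lambda>z. (z, a)"] ab
        by (fastforce intro!: continuous_intros)+
      show "continuous_on (closure X) (\<lambda>z. integral (cbox a t) (e z))"
        using cont_e t by (intro integral_continuous_on_param) (auto elim!: continuous_on_subset)
    qed
    from continuous_constant_on_closure[OF this _ x, of 0] inner show ?thesis by simp
  qed
  have "((\<lambda>u. c x a + integral {a..u} (e x)) has_real_derivative e x y) (at y within {a..b})"
    using integral_has_real_derivative[OF cont_ex[OF x] y]
    by (auto intro!: derivative_eq_intros)
  then show ?thesis
    unfolding has_field_derivative_def
    by (rule has_derivative_transform[OF y, rotated]) (rule repr)
qed

text \<open>The y-component \<open>e\<close> of the continuous extension \<open>D1\<close> is the
  partial derivative in the interior. By \<open>has_derivative_at_closure\<close> it is then the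
  derivative within {a..b} everywhere, which identifies \<open>cost_dy\<close> with it and makes
  \<open>cost_dy\<close> jointly continuous.\<close>

lemma C2_cost_dy:
  fixes X :: "(real^2) set"
  assumes ab: "a < b" and C2: "C2_up_to_closure (\<lambda>(x, y). c x y) (X \<times> {a<..<b})"
  shows "continuous_on (closure X \<times> {a..b}) (\<lambda>(x, y). c x y)"
    and "continuous_on (closure X \<times> {a..b}) (\<lambda>(x, y). cost_dy c a b x y)"
    and "\<And>x y. x \<in> closure X \<Longrightarrow> y \<in> {a..b} \<Longrightarrow>
      (c x has_real_derivative cost_dy c a b x y) (at y within {a..b})"
proof -
  have clos: "closure (X \<times> {a<..<b}) = closure X \<times> {a..b}"
    using ab by (simp add: closure_Times)
  obtain D1 :: "(real^2) \<times> real \<Rightarrow> ((real^2) \<times> real) \<Rightarrow>\<^sub>L real"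
    where D1: "continuous_on (closure X \<times> {a..b}) D1"
      "\<And>z. z \<in> X \<times> {a<..<b} \<Longrightarrow> ((\<lambda>(x, y). c x y) has_derivative blinfun_apply (D1 z)) (at z)"
    using C2 unfolding C2_up_to_closure_def clos by blast
  show cont_c: "continuous_on (closure X \<times> {a..b}) (\<lambda>(x, y). c x y)"
    using C2 unfolding C2_up_to_closure_def clos by blast
  define e where "e x y = D1 (x, y) (0, 1)" for x y
  have cont_e: "continuous_on (closure X \<times> {a..b}) (\<lambda>(x, y). e x y)"
    using D1(1) unfolding e_def by (simp add: case_prod_beta' blinfun.continuous_on)
  have deriv: "(c x has_real_derivative e x y) (at y)" if "x \<in> X" "y \<in> {a<..<b}" for x y
  proof -
    have "((\<lambda>(x, y). c x y) has_derivative blinfun_apply (D1 (x, y))) (at (x, y))"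
      using D1(2) that by simp
    then have "((\<lambda>t. (\<lambda>(x, y). c x y) (x, t)) has_derivative (\<lambda>h. D1 (x, y) (0, h))) (at y)"
      by (rule has_derivative_compose[rotated]) (auto intro!: derivative_eq_intros)
    moreover have "D1 (x, y) (0, h) = h * e x y" for h
      using blinfun.scaleR_right[of "D1 (x, y)" h "(0, 1)"] by (simp add: e_def)
    ultimately show ?thesis by (simp add: has_field_derivative_def mult.commute[of _ "e x y"])
  qed
  have e: "(c x has_real_derivative e x y) (at y within {a..b})"
    if "x \<in> closure X" "y \<in> {a..b}" for x y
    using has_derivative_at_closure[OF ab cont_c cont_e deriv that] .
  have dy: "cost_dy c a b x y = e x y" if "x \<in> closure X" "y \<in> {a..b}" for x y
    using vector_derivative_within_cbox[of a b y "c x" "e x y"] e[OF that] ab that(2)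
    by (simp add: cost_dy_def has_real_derivative_iff_has_vector_derivative)
  show "continuous_on (closure X \<times> {a..b}) (\<lambda>(x, y). cost_dy c a b x y)"
    using cont_e by (rule continuous_on_eq) (auto simp: dy)
  show "(c x has_real_derivative cost_dy c a b x y) (at y within {a..b})"
    if "x \<in> closure X" "y \<in> {a..b}" for x y
    using e dy that by simp
qed

section \<open>Mass splitting\<close>

text \<open>The function \<open>s\<close> stands for \<open>\<partial>c/\<partial>y\<close>. The point \<open>y\<close> splits the mass at \<open>x\<close> iff
  \<open>excess x y = 0\<close>; \<open>crosses_upward\<close> is membership in \<open>P\<close> and \<open>sweeps_less\<close> is the mass comparison
  property.\<close>

locale mass_splitting =
  fixes X :: "'a::euclidean_space set" and a b :: real
    and s :: "'a \<Rightarrow> real \<Rightarrow> real" and \<mu> :: "'a measure" and \<nu> :: "real measure"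
  assumes X: "open X" "connected X" "X \<noteq> {}" "bounded X"
    and ab: "a < b"
    and cont_s: "continuous_on (closure X \<times> {a..b}) (\<lambda>(x, y). s x y)"
    and prob_\<mu>: "prob_space \<mu>" and sets_\<mu>: "sets \<mu> = sets borel" and \<mu>_X: "measure \<mu> X = 1"
    and \<mu>_pos: "\<And>U. open U \<Longrightarrow> U \<inter> X \<noteq> {} \<Longrightarrow> 0 < measure \<mu> U"
    and \<mu>_level: "\<And>y t. y \<in> {a..b} \<Longrightarrow> measure \<mu> {x\<in>X. s x y = t} = 0"
    and above: "\<And>x y. x \<in> X \<Longrightarrow> y \<in> {a..b} \<Longrightarrow> \<exists>z\<in>X. s x y < s z y"
    and below: "\<And>x y. x \<in> X \<Longrightarrow> y \<in> {a..b} \<Longrightarrow> \<exists>z\<in>X. s z y < s x y"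
    and prob_\<nu>: "prob_space \<nu>" and sets_\<nu>: "sets \<nu> = sets borel"
    and \<nu>_Y: "measure \<nu> {a<..<b} = 1" and \<nu>_atom: "\<And>y. measure \<nu> {y} = 0"
begin

definition excess :: "'a \<Rightarrow> real \<Rightarrow> real" where
  "excess x y = measure \<mu> {x'\<in>X. s x y < s x' y} - measure \<nu> {a..<y}"

definition crosses_upward :: "'a \<Rightarrow> bool" where
  "crosses_upward p \<longleftrightarrow> (\<forall>y0\<in>{a<..<b}. \<forall>y1\<in>{a<..<b}. y0 < y1 \<longrightarrow>
     (\<forall>x\<in>closure X. s x y0 = s p y0 \<longrightarrow> s p y1 \<le> s x y1))"

definition sweeps_less :: "'a \<Rightarrow> bool" where
  "sweeps_less p \<longleftrightarrow> (\<forall>y0\<in>{a<..<b}. \<forall>y1\<in>{a<..<b}. y0 < y1 \<longrightarrow>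
     measure \<mu> (\<Union>y\<in>{y0..y1}. {x\<in>closure X. s x y = s p y}) < measure \<nu> {y0..y1})"

interpretation \<mu>: prob_space \<mu> by (rule prob_\<mu>)
interpretation \<nu>: prob_space \<nu> by (rule prob_\<nu>)

section \<open>Measurability of level sets and continuity of the excess\<close>

lemma compact_K: "compact (closure X)" using X(4) by simp

lemma connected_K: "connected (closure X)" using X(2) by (rule connected_imp_connected_closure)

lemma sub_K: "x \<in> X \<Longrightarrow> x \<in> closure X" using closure_subset by blast

lemma cont_s_x: "y \<in> {a..b} \<Longrightarrow> continuous_on (closure X) (\<lambda>x. s x y)"
  using continuous_on_compose2[OF cont_s, of "closure X" "\<lambda>x. (x, y)"]
  by (fastforce intro!: continuous_intros)

lemma cont_s_y: "x \<in> closure X \<Longrightarrow> continuous_on {a..b} (s x)"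
  using continuous_on_compose2[OF cont_s, of "{a..b}" "\<lambda>y. (x, y)"]
  by (fastforce intro!: continuous_intros)

lemma open_between:
  assumes "y \<in> {a..b}"
  shows "open {x\<in>X. t < s x y}" "open {x\<in>X. t < s x y \<and> s x y < u}"
proof -
  have c: "continuous_on X (\<lambda>x. s x y)"
    using cont_s_x[OF assms] closure_subset by (rule continuous_on_subset)
  show "open {x\<in>X. t < s x y}"
    using continuous_open_preimage[OF c X(1), of "{t<..}"]
    by (simp add: vimage_def Int_def)
  show "open {x\<in>X. t < s x y \<and> s x y < u}"
    using continuous_open_preimage[OF c X(1), of "{t<..<u}"]
    by (simp add: vimage_def Int_def)
qed

lemma sets_above: "y \<in> {a..b} \<Longrightarrow> {x\<in>X. t < s x y} \<in> sets \<mu>"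
  using open_between(1) sets_\<mu> by simp

lemma sets_level: "y \<in> {a..b} \<Longrightarrow> {x\<in>X. s x y = t} \<in> sets \<mu>"
proof -
  assume y: "y \<in> {a..b}"
  have c: "continuous_on X (\<lambda>x. s x y)"
    using cont_s_x[OF y] closure_subset by (rule continuous_on_subset)
  have "closedin (top_of_set X) {x\<in>X. s x y = t}"
    using continuous_closedin_preimage_constant[OF c] .
  then obtain T where "closed T" "{x\<in>X. s x y = t} = X \<inter> T"
    unfolding closedin_closed by blast
  then show ?thesis using X(1) sets_\<mu> by simp
qed

lemma AE_\<mu>_X: "AE x in \<mu>. x \<in> X"
  using \<mu>_X X(1) sets_\<mu> by (simp add: \<mu>.prob_eq_1)

lemma AE_\<nu>_Y: "AE y in \<nu>. y \<in> {a<..<b}"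
  using \<nu>_Y sets_\<nu> by (simp add: \<nu>.prob_eq_1)

lemma AE_\<mu>_level: "y \<in> {a..b} \<Longrightarrow> AE x in \<mu>. s x y \<noteq> t"
proof -
  assume y: "y \<in> {a..b}"
  have "{x\<in>X. s x y = t} \<in> null_sets \<mu>"
    using \<mu>_level[OF y] sets_level[OF y] by (simp add: null_sets_def \<mu>.emeasure_eq_measure)
  then have "AE x in \<mu>. x \<notin> {x\<in>X. s x y = t}" by (rule AE_not_in)
  with AE_\<mu>_X show ?thesis by eventually_elim auto
qed

lemma \<nu>_interval_eq_cdf: "y \<in> {a..b} \<Longrightarrow> measure \<nu> {a..<y} = cdf \<nu> y"
proof -
  assume y: "y \<in> {a..b}"
  have "{y} \<in> null_sets \<nu>"
    using \<nu>_atom[of y] sets_\<nu> by (simp add: null_sets_def \<nu>.emeasure_eq_measure)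
  then have 2: "AE t in \<nu>. t \<notin> {y}" by (rule AE_not_in)
  have "measure \<nu> {a..<y} = measure \<nu> {..y}"
    using sets_\<nu> AE_\<nu>_Y 2 by (intro \<nu>.finite_measure_eq_AE) (auto elim!: eventually_elim2)
  then show ?thesis by (simp add: cdf_def)
qed

lemma cont_cdf: "isCont (cdf \<nu>) y"
proof -
  interpret finite_borel_measure \<nu> by standard (rule sets_\<nu>)
  show ?thesis using \<nu>_atom isCont_cdf by simp
qed

lemma \<nu>_Icc:
  assumes "a \<le> y0" "y0 \<le> y1" "y1 \<le> b"
  shows "measure \<nu> {y0..y1} = measure \<nu> {a..<y1} - measure \<nu> {a..<y0}"
proof -
  have "{y1} \<in> null_sets \<nu>"
    using \<nu>_atom[of y1] sets_\<nu> by (simp add: null_sets_def \<nu>.emeasure_eq_measure)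
  then have "AE t in \<nu>. t \<notin> {y1}" by (rule AE_not_in)
  then have "measure \<nu> {y0..y1} = measure \<nu> {y0..<y1}"
    using sets_\<nu> by (intro \<nu>.finite_measure_eq_AE) (auto elim!: eventually_mono)
  also have "{y0..<y1} = {a..<y1} - {a..<y0}" using assms by auto
  also have "measure \<nu> \<dots> = measure \<nu> {a..<y1} - measure \<nu> {a..<y0}"
    using sets_\<nu> assms by (intro \<nu>.finite_measure_Diff) auto
  finally show ?thesis .
qed

text \<open>Dominated convergence: along a convergent sequence of pairs the indicators of the
  superlevel sets are eventually constant at every point of \<open>X\<close> off the limiting level
  set, which is \<mu>-null. The \<nu>-term is continuous because \<nu> has no atoms.\<close>

lemma cont_excess: "continuous_on (closure X \<times> {a..b}) (\<lambda>(x, y). excess x y)"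
  unfolding continuous_on_sequentially
proof (intro allI ballI impI)
  fix w :: "nat \<Rightarrow> 'a \<times> real" and z
  assume zK: "z \<in> closure X \<times> {a..b}" and w: "(\<forall>n. w n \<in> closure X \<times> {a..b}) \<and> w \<longlonglongrightarrow> z"
  obtain x y where z: "z = (x, y)" by force
  have xy: "x \<in> closure X" "y \<in> {a..b}" using zK z by auto
  define u where "u n = fst (w n)" for n
  define v where "v n = snd (w n)" for n
  have uv: "u n \<in> closure X" "v n \<in> {a..b}" for n
    using w by (metis mem_Times_iff u_def) (metis w mem_Times_iff v_def)
  have lim: "u \<longlonglongrightarrow> x" "v \<longlonglongrightarrow> y"
    using w z tendsto_fst[of w z] tendsto_snd[of w z] unfolding u_def v_def by auto
  have s_lim: "(\<lambda>n. s (u' n) (v n)) \<longlonglongrightarrow> s x' y"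
    if "\<And>n. u' n \<in> closure X" "u' \<longlonglongrightarrow> x'" "x' \<in> closure X" for u' x'
    using continuous_on_tendsto_compose[OF cont_s, of "\<lambda>n. (u' n, v n)" "(x', y)" sequentially]
      that lim(2) uv(2) xy(2) by (auto intro: tendsto_Pair)
  have "(\<lambda>n. integral\<^sup>L \<mu> (indicator {x'\<in>X. s (u n) (v n) < s x' (v n)} :: 'a \<Rightarrow> real))
      \<longlonglongrightarrow> integral\<^sup>L \<mu> (indicator {x'\<in>X. s x y < s x' y})"
  proof (rule integral_dominated_convergence[where w = "\<lambda>_. 1"])
    show "AE x' in \<mu>. (\<lambda>n. indicat_real {x' \<in> X. s (u n) (v n) < s x' (v n)} x')
        \<longlonglongrightarrow> indicat_real {x' \<in> X. s x y < s x' y} x'"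
      using AE_\<mu>_X AE_\<mu>_level[OF xy(2), of "s x y"]
    proof eventually_elim
      case (elim x')
      have l: "(\<lambda>n. s (u n) (v n)) \<longlonglongrightarrow> s x y" "(\<lambda>n. s x' (v n)) \<longlonglongrightarrow> s x' y"
        using s_lim[OF uv(1) lim(1) xy(1)] s_lim[of "\<lambda>_. x'" x'] sub_K[OF elim(1)] by auto
      then have d: "(\<lambda>n. s x' (v n) - s (u n) (v n)) \<longlonglongrightarrow> s x' y - s x y" by (intro tendsto_diff)
      have "eventually (\<lambda>n. (s (u n) (v n) < s x' (v n)) = (s x y < s x' y)) sequentially"
      proof (cases "s x y < s x' y")
        case True
        then show ?thesis using order_tendstoD(1)[OF d, of 0] by (auto elim!: eventually_mono)
      next
        case False
        then have "s x' y - s x y < 0" using elim(2) by auto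
        then show ?thesis using False order_tendstoD(2)[OF d, of 0] by (auto elim!: eventually_mono)
      qed
      then have "eventually (\<lambda>n. indicat_real {x' \<in> X. s (u n) (v n) < s x' (v n)} x'
          = indicat_real {x' \<in> X. s x y < s x' y} x') sequentially"
        by eventually_elim (simp add: indicator_def)
      then show ?case by (rule tendsto_eventually)
    qed
  qed (use sets_above xy(2) uv(2) in \<open>auto simp: indicator_def\<close>)
  then have 1: "(\<lambda>n. measure \<mu> {x'\<in>X. s (u n) (v n) < s x' (v n)}) \<longlonglongrightarrow> measure \<mu> {x'\<in>X. s x y < s x' y}"
    using sets_above[OF uv(2)] sets_above[OF xy(2)] by simp
  have "(\<lambda>n. cdf \<nu> (v n)) \<longlonglongrightarrow> cdf \<nu> y"
    using isCont_tendsto_compose[OF cont_cdf lim(2)] .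
  then have 2: "(\<lambda>n. measure \<nu> {a..<v n}) \<longlonglongrightarrow> measure \<nu> {a..<y}"
    using \<nu>_interval_eq_cdf uv(2) xy(2) by simp
  show "((\<lambda>(x, y). excess x y) \<circ> w) \<longlonglongrightarrow> (\<lambda>(x, y). excess x y) z"
    using tendsto_diff[OF 1 2] unfolding z excess_def u_def v_def by (simp add: comp_def case_prod_beta)
qed

lemma excess_tendsto:
  assumes "\<And>n. u n \<in> closure X" "\<And>n. v n \<in> {a..b}" "u \<longlonglongrightarrow> x" "v \<longlonglongrightarrow> y"
    "x \<in> closure X" "y \<in> {a..b}"
  shows "(\<lambda>n. excess (u n) (v n)) \<longlonglongrightarrow> excess x y"
  using continuous_on_tendsto_compose[OF cont_excess, of "\<lambda>n. (u n, v n)" "(x, y)" sequentially] assms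
  by (auto intro: tendsto_Pair)

lemma cont_excess_x: "y \<in> {a..b} \<Longrightarrow> continuous_on (closure X) (\<lambda>x. excess x y)"
  using continuous_on_compose2[OF cont_excess, of "closure X" "\<lambda>x. (x, y)"]
  by (fastforce intro!: continuous_intros)

lemma cont_excess_y: "x \<in> closure X \<Longrightarrow> continuous_on {a..b} (excess x)"
  using continuous_on_compose2[OF cont_excess, of "{a..b}" "\<lambda>y. (x, y)"]
  by (fastforce intro!: continuous_intros)

section \<open>Order of points by level and by excess\<close>

lemma excess_antimono:
  assumes "y \<in> {a..b}" "s x y \<le> s z y"
  shows "excess z y \<le> excess x y"
  unfolding excess_def
  using assms sets_above by (intro diff_right_mono \<mu>.finite_measure_mono) auto

text \<open>Connectedness of the closure yields an intermediate level, attained there and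
  approximated from \<open>X\<close>. The points of \<open>X\<close> strictly between the two levels
  thus form a nonempty open set, which has positive mass and is lost when passing from x to
  z.\<close>

lemma excess_strict_antimono:
  assumes "y \<in> {a..b}" "x \<in> closure X" "z \<in> closure X" "s x y < s z y"
  shows "excess z y < excess x y"
proof -
  obtain t where t: "s x y < t" "t < s z y" using assms(4) dense by blast
  have "connected ((\<lambda>x. s x y) ` closure X)"
    using cont_s_x[OF assms(1)] connected_K by (rule connected_continuous_image)
  then have "t \<in> (\<lambda>x. s x y) ` closure X"
    using connectedD_interval[of _ "s x y" "s z y" t] t assms(2,3) by auto
  then obtain w where w: "w \<in> closure X" "s w y = t" by auto
  obtain u where u: "\<And>n. u n \<in> X" "u \<longlonglongrightarrow> w"
    using w(1) closure_sequential by metis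
  have "(\<lambda>n. s (u n) y) \<longlonglongrightarrow> t"
    using continuous_on_tendsto_compose[OF cont_s_x[OF assms(1)] u(2) w(1)] u(1) sub_K w(2) by auto
  then have "eventually (\<lambda>n. s x y < s (u n) y \<and> s (u n) y < s z y) sequentially"
    using t by (intro eventually_conj order_tendstoD[of _ t])
  then obtain n where "s x y < s (u n) y" "s (u n) y < s z y"
    using eventually_happens'[OF sequentially_bot] by blast
  then have ne: "{x'\<in>X. s x y < s x' y \<and> s x' y < s z y} \<inter> X \<noteq> {}" using u(1) by auto
  let ?U = "{x'\<in>X. s x y < s x' y \<and> s x' y < s z y}"
  have "0 < measure \<mu> ?U" using open_between(2)[OF assms(1)] ne by (rule \<mu>_pos)
  moreover have "measure \<mu> (?U \<union> {x'\<in>X. s z y < s x' y}) = measure \<mu> ?U + measure \<mu> {x'\<in>X. s z y < s x' y}"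
    using open_between[OF assms(1)] sets_\<mu> by (intro \<mu>.finite_measure_Union) auto
  moreover have "measure \<mu> (?U \<union> {x'\<in>X. s z y < s x' y}) \<le> measure \<mu> {x'\<in>X. s x y < s x' y}"
    using assms(4) sets_above[OF assms(1)] by (intro \<mu>.finite_measure_mono) auto
  ultimately show ?thesis unfolding excess_def by simp
qed

lemma excess_less_iff:
  assumes "y \<in> {a..b}" "x \<in> closure X" "z \<in> closure X"
  shows "excess z y < excess x y \<longleftrightarrow> s x y < s z y"
  using excess_strict_antimono[OF assms] excess_antimono[OF assms(1)] by (meson not_le)

lemma excess_eq_iff:
  assumes "y \<in> {a..b}" "x \<in> closure X" "z \<in> closure X"
  shows "excess z y = excess x y \<longleftrightarrow> s x y = s z y"
  using excess_less_iff[OF assms] excess_less_iff[OF assms(1,3,2)] by force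

lemma \<nu>_total: "measure \<nu> {a..<b} = 1"
proof -
  have "measure \<nu> {a<..<b} \<le> measure \<nu> {a..<b}"
    using sets_\<nu> by (intro \<nu>.finite_measure_mono) auto
  then show ?thesis using \<nu>_Y \<nu>.prob_le_1[of "{a..<b}"] by linarith
qed

lemma excess_ends: "0 \<le> excess x a" "excess x b \<le> 0"
  using \<nu>_total by (auto simp: excess_def)

text \<open>A point of \<open>X\<close> is not extremal for s(.,a) or s(.,b). Some z lies strictly
  above it at \<open>a\<close>, or strictly below it at \<open>b\<close>, and the weak sign of the
  excess of z becomes strict for x.\<close>

lemma excess_ends_strict:
  assumes "x \<in> X"
  shows "0 < excess x a" "excess x b < 0"
proof -
  have a: "a \<in> {a..b}" and b: "b \<in> {a..b}" using ab by auto
  obtain z where z: "z \<in> X" "s x a < s z a" using above[OF assms a] by blast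
  show "0 < excess x a"
    using excess_strict_antimono[OF a _ _ z(2)] sub_K assms z(1) excess_ends(1)[of z] by fastforce
  obtain z where z: "z \<in> X" "s z b < s x b" using below[OF assms b] by blast
  show "excess x b < 0"
    using excess_strict_antimono[OF b _ _ z(2)] sub_K assms z(1) excess_ends(2)[of z] by fastforce
qed

lemma zero_between:
  assumes "x \<in> closure X" "a \<le> l" "l \<le> r" "r \<le> b" "0 \<le> excess x l" "excess x r \<le> 0"
  shows "\<exists>y\<ge>l. y \<le> r \<and> excess x y = 0"
  using assms
  by (intro IVT2'[of "excess x" r 0 l])
    (auto intro!: continuous_on_subset[OF cont_excess_y[OF assms(1)]])

text \<open>At a maximum point of s(.,y) no mass lies above, and at a minimum point almost all mass
  does, since level sets are null. So the excess takes both weak signs on the connected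
  closure.\<close>

lemma level_exists:
  assumes y: "y \<in> {a..b}"
  shows "\<exists>x\<in>closure X. excess x y = 0"
proof -
  have ne: "closure X \<noteq> {}" using X(3) by simp
  obtain p where p: "p \<in> closure X" "\<And>x. x \<in> closure X \<Longrightarrow> s p y \<le> s x y"
    using continuous_attains_inf[OF compact_K ne cont_s_x[OF y]] by blast
  obtain q where q: "q \<in> closure X" "\<And>x. x \<in> closure X \<Longrightarrow> s x y \<le> s q y"
    using continuous_attains_sup[OF compact_K ne cont_s_x[OF y]] by blast
  have "{x'\<in>X. s q y < s x' y} = {}" using q(2) sub_K by fastforce
  then have 1: "excess q y \<le> 0" unfolding excess_def by (simp only: measure_empty) simp
  have "measure \<mu> {x'\<in>X. s p y < s x' y} = 1"
  proof -
    have "AE x in \<mu>. x \<in> {x'\<in>X. s p y < s x' y}"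
      using AE_\<mu>_X AE_\<mu>_level[OF y, of "s p y"]
      by eventually_elim (use p(2) sub_K in fastforce)
    then show ?thesis using sets_above[OF y] by (simp add: \<mu>.prob_eq_1)
  qed
  then have 2: "0 \<le> excess p y" unfolding excess_def by simp
  have "connected ((\<lambda>x. excess x y) ` closure X)"
    using cont_excess_x[OF y] connected_K by (rule connected_continuous_image)
  then have "0 \<in> (\<lambda>x. excess x y) ` closure X"
    using connectedD_interval[of _ "excess q y" "excess p y" 0] 1 2 p(1) q(1) by auto
  then show ?thesis by auto
qed

end

text \<open>Continuity extends only weak inequalities to the end points; strictness is recovered
  from the drop between two auxiliary interior points q < r.\<close>

lemma strict_antimono_Icc:
  fixes f :: "real \<Rightarrow> real"
  assumes cont: "continuous_on {a..b} f"
    and less: "\<And>y0 y1. a < y0 \<Longrightarrow> y0 < y1 \<Longrightarrow> y1 < b \<Longrightarrow> f y1 < f y0"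
    and y: "a \<le> y0" "y0 < y1" "y1 \<le> b"
  shows "f y1 < f y0"
proof -
  obtain q where q: "y0 < q" "q < y1" using y(2) dense by blast
  obtain r where r: "q < r" "r < y1" using q(2) dense by blast
  have "f q \<le> f y0"
  proof (rule continuous_ge_on_closure[where f = f and S = "{y0<..<q}"])
    show "continuous_on (closure {y0<..<q}) f"
      using q y by (intro continuous_on_subset[OF cont]) auto
    show "y0 \<in> closure {y0<..<q}" using q by simp
    show "f q \<le> f t" if "t \<in> {y0<..<q}" for t
      using less[of t q] that y q by (intro less_imp_le) auto
  qed
  moreover have "f y1 \<le> f r"
  proof (rule continuous_le_on_closure[where f = f and S = "{r<..<y1}"])
    show "continuous_on (closure {r<..<y1}) f"
      using q r y by (intro continuous_on_subset[OF cont]) auto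
    show "y1 \<in> closure {r<..<y1}" using r by simp
    show "f t \<le> f r" if "t \<in> {r<..<y1}" for t
      using less[of r t] that y q r by (intro less_imp_le) auto
  qed
  moreover have "f r < f q" using less[of q r] q r y by simp
  ultimately show ?thesis by linarith
qed

section \<open>Consequences of the mass comparison property and of membership in P\<close>

context mass_splitting
begin

interpretation \<mu>: prob_space \<mu> by (rule prob_\<mu>)

text \<open>The swept set is an uncountable union, so its measurability needs an argument: it is the
  projection of a compact set of pairs.\<close>

lemma closed_swept:
  assumes p: "p \<in> closure X" and y: "a \<le> y0" "y1 \<le> b"
  shows "closed (\<Union>y\<in>{y0..y1}. {x\<in>closure X. s x y = s p y})"
proof -
  let ?K = "closure X \<times> {y0..y1}"
  have c: "continuous_on ?K (\<lambda>z. s (fst z) (snd z) - s p (snd z))"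
  proof (intro continuous_on_diff)
    show "continuous_on ?K (\<lambda>z. s (fst z) (snd z))"
      using y by (intro continuous_on_subset[OF cont_s, unfolded case_prod_beta'] Sigma_mono) auto
    show "continuous_on ?K (\<lambda>z. s p (snd z))"
      using cont_s_y[OF p] y by (rule_tac continuous_on_compose2[where g = "s p"])
        (auto intro!: continuous_intros)
  qed
  have "compact ?K" using compact_K by (simp add: compact_Times)
  then have "compact {z\<in>?K. s (fst z) (snd z) - s p (snd z) = 0}"
    using continuous_closed_preimage_constant[OF c, of 0] compact_imp_closed
    by (metis (no_types, lifting) compact_Int_closed inf.absorb_iff2 mem_Collect_eq subsetI)
  then have "compact (fst ` {z\<in>?K. s (fst z) (snd z) - s p (snd z) = 0})"
    by (intro compact_continuous_image continuous_intros)
  also have "fst ` {z\<in>?K. s (fst z) (snd z) - s p (snd z) = 0}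
      = (\<Union>y\<in>{y0..y1}. {x\<in>closure X. s x y = s p y})"
    by (force simp: image_iff)
  finally show ?thesis by (rule compact_imp_closed)
qed

text \<open>A point that enters the superlevel set of p between y0 and y1 must meet the level of p
  on the way, by the intermediate value theorem. The gain in \<mu>-mass is therefore at most the
  swept mass, which is less than the \<nu>-mass added at the same time.\<close>

lemma sweeps_less_decreasing:
  assumes p: "p \<in> closure X" "sweeps_less p" and y: "a \<le> y0" "y0 < y1" "y1 \<le> b"
  shows "excess p y1 < excess p y0"
proof (rule strict_antimono_Icc[OF cont_excess_y[OF p(1)] _ y])
  fix y0 y1 assume y: "a < y0" "y0 < y1" "y1 < b"
  let ?S = "\<Union>y\<in>{y0..y1}. {x\<in>closure X. s x y = s p y}"
  have S: "?S \<in> sets \<mu>" using closed_swept[OF p(1)] y sets_\<mu> by simp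
  have "{x\<in>X. s p y1 < s x y1} \<subseteq> {x\<in>X. s p y0 < s x y0} \<union> ?S"
  proof
    fix x assume x: "x \<in> {x\<in>X. s p y1 < s x y1}"
    show "x \<in> {x\<in>X. s p y0 < s x y0} \<union> ?S"
    proof (cases "s p y0 < s x y0")
      case False
      have "\<exists>t\<ge>y0. t \<le> y1 \<and> s x t - s p t = 0"
        using x y False p(1) sub_K
        by (intro IVT' continuous_on_diff) (auto intro!: continuous_on_subset[OF cont_s_y])
      then show ?thesis using x sub_K by auto
    qed (use x in auto)
  qed
  then have "measure \<mu> {x\<in>X. s p y1 < s x y1} \<le> measure \<mu> ({x\<in>X. s p y0 < s x y0} \<union> ?S)"
    using S sets_above[of y0] y by (intro \<mu>.finite_measure_mono) auto
  also have "\<dots> \<le> measure \<mu> {x\<in>X. s p y0 < s x y0} + measure \<mu> ?S"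
    using S sets_above[of y0] y by (intro measure_Un_le) auto
  also have "measure \<mu> ?S < measure \<nu> {y0..y1}"
    using p(2) y unfolding sweeps_less_def by auto
  also have "measure \<nu> {y0..y1} = measure \<nu> {a..<y1} - measure \<nu> {a..<y0}"
    using y by (intro \<nu>_Icc) auto
  finally show "excess p y1 < excess p y0" by (simp add: excess_def)
qed

text \<open>\<open>crosses_upward\<close> speaks of interior y1 only; continuity in y adds y1 =
  b.\<close>

lemma crosses_upward_le:
  assumes p: "p \<in> closure X" "crosses_upward p" and x: "x \<in> closure X"
    and y: "a < y0" "y0 < y1" "y1 \<le> b" and eq: "s x y0 = s p y0"
  shows "s p y1 \<le> s x y1"
proof -
  have "0 \<le> s x y1 - s p y1"
  proof (rule continuous_ge_on_closure[where f = "\<lambda>t. s x t - s p t" and S = "{y0<..<y1}"])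
    show "continuous_on (closure {y0<..<y1}) (\<lambda>t. s x t - s p t)"
      using p x y by (auto intro!: continuous_intros continuous_on_subset[OF cont_s_y])
    show "y1 \<in> closure {y0<..<y1}" using y by simp
    show "0 \<le> s x t - s p t" if "t \<in> {y0<..<y1}" for t
      using p(2)[unfolded crosses_upward_def, rule_format, of y0 t x] x y eq that by simp
  qed
  then show ?thesis by simp
qed

lemma excess_cong: "y \<in> {a..b} \<Longrightarrow> s x y = s z y \<Longrightarrow> excess x y = excess z y"
  by (simp add: excess_def)

end

section \<open>Uniqueness of the splitting point and the splitting map\<close>

locale anchored_splitting = mass_splitting +
  assumes anchor: "\<And>x y. x \<in> closure X \<Longrightarrow> y \<in> {a..b} \<Longrightarrow> excess x y = 0 \<Longrightarrow>
    \<exists>p\<in>closure X. s p y = s x y \<and> crosses_upward p \<and> sweeps_less p"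
begin

lemma anchorE:
  assumes "x \<in> closure X" "y \<in> {a..b}" "excess x y = 0"
  obtains p where "p \<in> closure X" "s p y = s x y" "excess p y = 0" "crosses_upward p" "sweeps_less p"
  using anchor[OF assms] excess_cong[OF assms(2)] assms(3) by metis

lemma excess_neg_after_zero:
  assumes x: "x \<in> closure X" "excess x y0 = 0" and y: "a < y0" "y0 < y1" "y1 \<le> b"
  shows "excess x y1 < 0"
proof -
  obtain p where p: "p \<in> closure X" "s p y0 = s x y0" "excess p y0 = 0" "crosses_upward p" "sweeps_less p"
    using anchorE[of x y0] x y by auto
  have "s p y1 \<le> s x y1" using crosses_upward_le[OF p(1,4) x(1) y] p(2) by simp
  then have "excess x y1 \<le> excess p y1" using y by (intro excess_antimono) auto
  also have "\<dots> < excess p y0" using sweeps_less_decreasing[OF p(1,5)] y by simp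
  finally show ?thesis using p(3) by simp
qed

text \<open>At \<open>y = a\<close> the argument of \<open>excess_neg_after_zero\<close> is not available, as \<open>P\<close> only controls level
  sets at interior \<open>y\<close>. If \<open>excess x y > 0\<close>, then the anchor \<open>p\<close> of level \<open>y\<close> would see
  \<open>s x - s p\<close> change from positive to negative, which \<open>p \<in> P\<close> forbids.\<close>

lemma excess_nonpos_if_zero_at_left:
  assumes x: "x \<in> closure X" "excess x a = 0" and y: "a < y" "y < b"
  shows "excess x y \<le> 0"
proof (rule ccontr)
  assume "\<not> excess x y \<le> 0"
  then have pos: "0 < excess x y" by simp
  have yI: "y \<in> {a..b}" and aI: "a \<in> {a..b}" using y ab by auto
  obtain x0 where "x0 \<in> closure X" "excess x0 y = 0" using level_exists[OF yI] by blast
  then obtain p where p: "p \<in> closure X" "excess p y = 0" "crosses_upward p" "sweeps_less p"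
    using anchorE yI by metis
  have "0 < excess p a" using sweeps_less_decreasing[OF p(1,4), of a y] y p(2) by simp
  then have 1: "s p a < s x a" using excess_less_iff[OF aI p(1) x(1)] x(2) by simp
  have 2: "s x y < s p y" using excess_less_iff[OF yI x(1) p(1)] p(2) pos by simp
  have "\<exists>t\<ge>a. t \<le> y \<and> s x t - s p t = 0"
    using 1 2 y p(1) x(1)
    by (intro IVT2' continuous_on_diff) (auto intro!: continuous_on_subset[OF cont_s_y])
  then obtain t where t: "a \<le> t" "t \<le> y" "s x t = s p t" by auto
  then have "a < t" "t < y" using 1 2 by (auto simp: order.order_iff_strict)
  then have "s p y \<le> s x y" using crosses_upward_le[OF p(1,3) x(1)] t(3) y by simp
  then show False using 2 by simp
qed

text \<open>Were \<open>y1\<close> a second zero, then points \<open>z n\<close> of \<open>X\<close> near \<open>x\<close> would split at some \<open>r n\<close> tending to \<open>a\<close>,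
  with anchors \<open>p n\<close>. The decreasing functions \<open>excess (p n)\<close> vanish at \<open>r n\<close> and are asymptotically
  nonnegative at \<open>y1\<close>, so a limit \<open>q\<close> of the anchors splits at every point between \<open>a\<close> and \<open>y1\<close>.\<close>

lemma no_zero_after_left:
  assumes x: "x \<in> closure X" "excess x a = 0" and y: "a < y1" "y1 \<le> b"
  shows "excess x y1 \<noteq> 0"
proof
  assume zero: "excess x y1 = 0"
  \<comment> \<open>The excess is already known to be nonpositive here, and a zero at t > a would
    make it negative at \<open>y1\<close>.\<close>
  have neg: "excess x t < 0" if "a < t" "t < y1" for t
    using excess_nonpos_if_zero_at_left[OF x, of t] excess_neg_after_zero[OF x(1), of t y1] zero that y
    by (cases "excess x t = 0") auto
  \<comment> \<open>Any sequence in (a, y1) decreasing to a serves; with n + 1 in the denominator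
    the first term would be y1 itself.\<close>
  define t where "t n = a + (y1 - a) / real (n + 2)" for n :: nat
  have t: "a < t n" "t n < y1" for n
  proof -
    show "a < t n" using y by (simp add: t_def)
    have "(y1 - a) * 1 < (y1 - a) * real (n + 2)" using y by (intro mult_strict_left_mono) auto
    then have "(y1 - a) / real (n + 2) < y1 - a" by (subst divide_less_eq) simp
    then show "t n < y1" by (simp add: t_def)
  qed
  have t_lim: "t \<longlonglongrightarrow> a"
    unfolding t_def
    using tendsto_add[OF tendsto_const[of a] LIMSEQ_ignore_initial_segment[OF lim_const_over_n, of "y1 - a" 2]]
    by simp
  have ex: "\<exists>z p r. z \<in> closure X \<and> dist z x < 1 / real (Suc n) \<and> p \<in> closure X \<and> sweeps_less p
      \<and> a < r \<and> r \<le> t n \<and> excess p r = 0 \<and> excess z y1 \<le> excess p y1" for n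
  proof -
    have tI: "t n \<in> {a..b}" using t[of n] y by simp
    obtain u where u: "\<And>k. u k \<in> X" "u \<longlonglongrightarrow> x" using x(1) closure_sequential by metis
    have "(\<lambda>k. excess (u k) (t n)) \<longlonglongrightarrow> excess x (t n)"
      using u sub_K x(1) tI by (intro excess_tendsto) auto
    then have "eventually (\<lambda>k. excess (u k) (t n) < 0 \<and> dist (u k) x < 1 / real (Suc n)) sequentially"
      using neg[OF t] tendstoD[OF u(2)] by (intro eventually_conj) (auto intro: order_tendstoD)
    then obtain k where k: "excess (u k) (t n) < 0" "dist (u k) x < 1 / real (Suc n)"
      using eventually_happens'[OF sequentially_bot] by blast
    define z where "z = u k"
    have z: "z \<in> X" "z \<in> closure X" using u(1) sub_K by (auto simp: z_def)
    \<comment> \<open>Points of \<open>X\<close> have positive excess at a, even though x itself has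
      excess 0 there. So the zero of z lies strictly to the right of a, where anchors can be
      compared with z at later y.\<close>
    obtain r where r: "a \<le> r" "r \<le> t n" "excess z r = 0"
      using zero_between[OF z(2), of a "t n"] excess_ends_strict[OF z(1)] k(1) t[of n] tI
      by (auto simp: z_def)
    have "a < r" using r excess_ends_strict(1)[OF z(1)] by (cases "a = r") auto
    obtain p where p: "p \<in> closure X" "s p r = s z r" "excess p r = 0" "crosses_upward p" "sweeps_less p"
      using anchorE[of z r] z r tI by auto
    have "s p y1 \<le> s z y1"
      using crosses_upward_le[OF p(1,4) z(2) \<open>a < r\<close>, of y1] p(2) r(2) t[of n] y by simp
    then have "excess z y1 \<le> excess p y1" using y by (intro excess_antimono) auto
    then show ?thesis using z k(2) p \<open>a < r\<close> r(2) unfolding z_def by blast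
  qed
  obtain z p r where zpr: "\<And>n. z n \<in> closure X" "\<And>n. dist (z n) x < 1 / real (Suc n)"
    "\<And>n. p n \<in> closure X" "\<And>n. sweeps_less (p n)" "\<And>n. a < r n" "\<And>n. r n \<le> t n"
    "\<And>n. excess (p n) (r n) = 0" "\<And>n. excess (z n) y1 \<le> excess (p n) y1"
    using ex by metis
  have z_lim: "z \<longlonglongrightarrow> x"
    using zpr(2) by (intro metric_tendsto_imp_tendsto[OF LIMSEQ_inverse_real_of_nat])
      (auto simp: inverse_eq_divide less_imp_le intro!: always_eventually)
  obtain q \<rho> where q: "q \<in> closure X" "strict_mono \<rho>" "(p \<circ> \<rho>) \<longlonglongrightarrow> q"
    using compact_K zpr(3) unfolding compact_def by meson
  have y1I: "y1 \<in> {a..b}" using y by simp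
  have z_lim': "(\<lambda>n. excess (z (\<rho> n)) y1) \<longlonglongrightarrow> 0"
    using excess_tendsto[of z "\<lambda>_. y1" x y1] zpr(1) z_lim x(1) y1I zero LIMSEQ_subseq_LIMSEQ[OF _ q(2)]
    by (force simp: comp_def)
  \<comment> \<open>The values excess (p (\<rho> n)) w are squeezed: from below by excess (z (\<rho>
    n)) y1, which tends to 0, and from above by the zero at r (\<rho> n), once this has dropped
    below w.\<close>
  have q_zero: "excess q w = 0" if w: "a < w" "w < y1" for w
  proof -
    have wI: "w \<in> {a..b}" using w y by simp
    have l: "(\<lambda>n. excess (p (\<rho> n)) w) \<longlonglongrightarrow> excess q w"
      using excess_tendsto[of "p \<circ> \<rho>" "\<lambda>_. w" q w] zpr(3) q(1,3) wI by (auto simp: comp_def)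
    have lower: "excess (z (\<rho> n)) y1 \<le> excess (p (\<rho> n)) w" for n
      using zpr(8)[of "\<rho> n"] sweeps_less_decreasing[OF zpr(3,4), of w y1 "\<rho> n"] w y by simp
    have "eventually (\<lambda>n. (t \<circ> \<rho>) n < w) sequentially"
      using LIMSEQ_subseq_LIMSEQ[OF t_lim q(2)] w(1) by (rule order_tendstoD)
    then have upper: "eventually (\<lambda>n. excess (p (\<rho> n)) w \<le> 0) sequentially"
    proof eventually_elim
      case (elim n)
      have "r (\<rho> n) < w" using elim zpr(6)[of "\<rho> n"] by simp
      then show ?case
        using sweeps_less_decreasing[OF zpr(3,4), of "r (\<rho> n)" w "\<rho> n"] zpr(5,7)[of "\<rho> n"] w y by simp
    qed
    have "0 \<le> excess q w" using lower by (intro LIMSEQ_le[OF z_lim' l]) auto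
    moreover have "excess q w \<le> 0" using upper by (intro tendsto_upperbound[OF l]) auto
    ultimately show ?thesis by simp
  qed
  \<comment> \<open>Two interior zeros of \<open>excess q\<close> contradict
    \<open>excess_neg_after_zero\<close>.\<close>
  obtain w where w: "a < w" "w < y1" using y(1) dense by blast
  obtain w' where w': "w < w'" "w' < y1" using w(2) dense by blast
  show False
    using excess_neg_after_zero[OF q(1) q_zero[OF w] w(1) w'(1)] q_zero[of w'] w w' y by simp
qed

lemma ex1_zero:
  assumes x: "x \<in> closure X"
  shows "\<exists>!y. y \<in> {a..b} \<and> excess x y = 0"
proof -
  obtain y where y: "y \<in> {a..b}" "excess x y = 0"
    using zero_between[OF x, of a b] ab excess_ends by auto
  have *: False if "u \<in> {a..b}" "v \<in> {a..b}" "u < v" "excess x u = 0" "excess x v = 0" for u v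
    using that no_zero_after_left[OF x, of v] excess_neg_after_zero[OF x, of u v]
    by (cases "u = a") auto
  show ?thesis
    using y * by (intro ex1I[of _ y]) (auto, metis atLeastAtMost_iff linorder_neqE_linordered_idom)
qed

text \<open>The constant value outside the closure makes the map Borel on the whole space.\<close>

definition splitting_map :: "'a \<Rightarrow> real" where
  "splitting_map x = (if x \<in> closure X then THE y. y \<in> {a..b} \<and> excess x y = 0 else a)"

lemma splitting_map:
  assumes "x \<in> closure X"
  shows "splitting_map x \<in> {a..b}" "excess x (splitting_map x) = 0"
    "y \<in> {a..b} \<Longrightarrow> excess x y = 0 \<longleftrightarrow> splitting_map x = y"
  using theI'[OF ex1_zero[OF assms]] ex1_zero[OF assms] assms unfolding splitting_map_def by auto

lemma splitting_map_interior:
  assumes "x \<in> X"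
  shows "a < splitting_map x" "splitting_map x < b"
  using splitting_map(1,2)[OF sub_K[OF assms]] excess_ends_strict[OF assms]
  by (metis atLeastAtMost_iff less_irrefl order.not_eq_order_implies_strict)+

text \<open>The excess has the weak signs + at a and - at b. A wrong sign at y would produce a
  second zero on the same side of the splitting point as y.\<close>

lemma excess_sign:
  assumes x: "x \<in> closure X" and y: "y \<in> {a..b}"
  shows "0 < excess x y \<longleftrightarrow> y < splitting_map x" "excess x y < 0 \<longleftrightarrow> splitting_map x < y"
proof -
  note m = splitting_map[OF x]
  have 1: "0 < excess x y" if l: "y < splitting_map x"
  proof (rule ccontr)
    assume "\<not> 0 < excess x y"
    then obtain t where "a \<le> t" "t \<le> y" "excess x t = 0"
      using zero_between[OF x, of a y] y excess_ends(1) by auto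
    then show False using m(3)[of t] l y by auto
  qed
  have 2: "excess x y < 0" if l: "splitting_map x < y"
  proof (rule ccontr)
    assume "\<not> excess x y < 0"
    then obtain t where "y \<le> t" "t \<le> b" "excess x t = 0"
      using zero_between[OF x, of y b] y excess_ends(2) by auto
    then show False using m(3)[of t] l y by auto
  qed
  show "0 < excess x y \<longleftrightarrow> y < splitting_map x" "excess x y < 0 \<longleftrightarrow> splitting_map x < y"
    using 1 2 m(2) m(3)[of y] y by (metis less_asym less_irrefl linorder_neqE_linordered_idom)+
qed

lemma compact_zero_set: "compact {z \<in> closure X \<times> {a..b}. excess (fst z) (snd z) = 0}"
proof -
  have "compact (closure X \<times> {a..b})" using compact_K by (simp add: compact_Times)
  moreover have c: "continuous_on (closure X \<times> {a..b}) (\<lambda>z. excess (fst z) (snd z))"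
    using cont_excess by (simp add: case_prod_beta')
  ultimately have "closed {z \<in> closure X \<times> {a..b}. excess (fst z) (snd z) = 0}"
    by (intro continuous_closed_preimage_constant compact_imp_closed)
  then have "compact ((closure X \<times> {a..b}) \<inter> {z \<in> closure X \<times> {a..b}. excess (fst z) (snd z) = 0})"
    using \<open>compact (closure X \<times> {a..b})\<close> by (intro compact_Int_closed)
  then show ?thesis by (simp add: Int_def cong: conj_cong)
qed

lemma graph_eq_zero_set:
  "(\<lambda>x. (x, splitting_map x)) ` closure X = {z \<in> closure X \<times> {a..b}. excess (fst z) (snd z) = 0}"
  using splitting_map by (auto simp: image_iff)

text \<open>Closed graph argument: the graph is the zero set of the continuous excess, and the
  values lie in a compact interval.\<close>

lemma cont_splitting_map: "continuous_on (closure X) splitting_map"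
  using splitting_map(1) compact_zero_set
  by (intro continuous_from_closed_graph[of "{a..b}"]) (auto simp: graph_eq_zero_set compact_imp_closed)

end

section \<open>The potential\<close>

context anchored_splitting
begin

interpretation \<mu>: prob_space \<mu> by (rule prob_\<mu>)
interpretation \<nu>: prob_space \<nu> by (rule prob_\<nu>)

text \<open>The level of \<open>s\<close> at which \<open>y\<close> splits the mass. Its primitive is the Kantorovich potential on \<open>Y\<close>.\<close>

definition threshold :: "real \<Rightarrow> real" where
  "threshold y = s (SOME x. x \<in> closure X \<and> excess x y = 0) y"

text \<open>Independent of the choice because two points with equal excess at y lie on the same
  level.\<close>

lemma threshold_eq:
  assumes y: "y \<in> {a..b}" and x: "x \<in> closure X" "excess x y = 0"
  shows "threshold y = s x y"
proof -
  define z where "z = (SOME x. x \<in> closure X \<and> excess x y = 0)"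
  have "z \<in> closure X \<and> excess z y = 0"
    unfolding z_def using someI[of "\<lambda>x. x \<in> closure X \<and> excess x y = 0" x] x by blast
  then show ?thesis
    unfolding threshold_def z_def[symmetric] using excess_eq_iff[OF y, of z x] x by simp
qed

text \<open>For z on the splitting level of y, lying below z means having larger excess than z, that
  is positive excess, that is splitting only after y. Both the push-forward property and the
  minimality of the splitting point rest on this.\<close>

lemma threshold_sign:
  assumes x: "x \<in> closure X" and y: "y \<in> {a..b}"
  shows "s x y < threshold y \<longleftrightarrow> y < splitting_map x" "threshold y < s x y \<longleftrightarrow> splitting_map x < y"
proof -
  obtain z where z: "z \<in> closure X" "excess z y = 0" using level_exists[OF y] by blast
  show "s x y < threshold y \<longleftrightarrow> y < splitting_map x" "threshold y < s x y \<longleftrightarrow> splitting_map x < y"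
    using excess_less_iff[OF y x z(1)] excess_less_iff[OF y z(1) x] excess_sign[OF x y]
      threshold_eq[OF y z] z(2) by auto
qed

text \<open>Again a closed graph: it is a continuous image of the compact zero set of the
  excess.\<close>

lemma cont_threshold: "continuous_on {a..b} threshold"
proof (rule continuous_from_closed_graph)
  let ?Z = "{z \<in> closure X \<times> {a..b}. excess (fst z) (snd z) = 0}"
  have cs: "continuous_on (closure X \<times> {a..b}) (\<lambda>z. s (fst z) (snd z))"
    using cont_s by (simp add: case_prod_beta')
  show "compact ((\<lambda>z. s (fst z) (snd z)) ` (closure X \<times> {a..b}))"
    using cs compact_K by (intro compact_continuous_image compact_Times) auto
  show "threshold \<in> {a..b} \<rightarrow> (\<lambda>z. s (fst z) (snd z)) ` (closure X \<times> {a..b})"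
    using level_exists threshold_eq by (fastforce simp: image_iff)
  have "compact ((\<lambda>z. (snd z, s (fst z) (snd z))) ` ?Z)"
    by (intro compact_continuous_image compact_zero_set continuous_intros continuous_on_subset[OF cs]) auto
  also have "(\<lambda>z. (snd z, s (fst z) (snd z))) ` ?Z = (\<lambda>y. (y, threshold y)) ` {a..b}"
    using level_exists threshold_eq by (fastforce simp: image_iff)
  finally show "closed ((\<lambda>y. (y, threshold y)) ` {a..b})" by (rule compact_imp_closed)
qed

lemma measurable_splitting_map: "splitting_map \<in> borel_measurable borel"
proof -
  have "(\<lambda>x. if x \<in> closure X then splitting_map x else a) \<in> borel_measurable borel"
    using cont_splitting_map by (intro borel_measurable_continuous_on_if) auto
  moreover have "(\<lambda>x. if x \<in> closure X then splitting_map x else a) = splitting_map"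
    by (auto simp: splitting_map_def)
  ultimately show ?thesis by simp
qed

text \<open>Distribution functions are compared. For y in {a..b} the points with splitting value at
  most y are, up to the null level set, those with s(x,y) above the threshold, and their mass is
  \<nu>[a,y) by the definition of splitting.\<close>

lemma distr_splitting_map: "distr \<mu> borel splitting_map = \<nu>"
proof (rule cdf_unique)
  have F[measurable]: "splitting_map \<in> measurable \<mu> borel"
    using measurable_splitting_map sets_\<mu> by (simp cong: measurable_cong_sets)
  show "real_distribution (distr \<mu> borel splitting_map)"
    using \<mu>.prob_space_distr[OF F] by (simp add: real_distribution_def real_distribution_axioms_def)
  show "real_distribution \<nu>"
    using prob_\<nu> sets_\<nu> sets_eq_imp_space_eq[OF sets_\<nu>]
    by (simp add: real_distribution_def real_distribution_axioms_def)
  have meas: "{x. splitting_map x \<le> y} \<in> sets \<mu>" for y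
    using measurable_sets[OF F, of "{..y}"] sets_eq_imp_space_eq[OF sets_\<mu>] by (simp add: vimage_def)
  show "cdf (distr \<mu> borel splitting_map) = cdf \<nu>"
  proof
    fix y
    have d: "cdf (distr \<mu> borel splitting_map) y = measure \<mu> {x. splitting_map x \<le> y}"
      using sets_eq_imp_space_eq[OF sets_\<mu>] F by (simp add: cdf_def measure_distr vimage_def)
    consider "y < a" | "b < y" | "y \<in> {a..b}" by force
    then show "cdf (distr \<mu> borel splitting_map) y = cdf \<nu> y"
    proof cases
      case 1
      have "AE x in \<mu>. \<not> splitting_map x \<le> y"
        using AE_\<mu>_X by eventually_elim (use 1 splitting_map(1)[OF sub_K] in force)
      then have "measure \<mu> {x. splitting_map x \<le> y} = measure \<mu> {}"
        using meas by (intro \<mu>.finite_measure_eq_AE) auto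
      moreover have "measure \<nu> {..y} = measure \<nu> {}"
        using AE_\<nu>_Y sets_\<nu> 1 by (intro \<nu>.finite_measure_eq_AE) (auto elim!: eventually_mono)
      ultimately show ?thesis unfolding d by (simp add: cdf_def)
    next
      case 2
      have "AE x in \<mu>. splitting_map x \<le> y"
        using AE_\<mu>_X by eventually_elim (use 2 splitting_map(1)[OF sub_K] in force)
      then have "measure \<mu> {x. splitting_map x \<le> y} = 1"
        using meas by (subst \<mu>.prob_eq_1) auto
      moreover have "measure \<nu> {..y} = 1"
      proof -
        have "AE t in \<nu>. t \<in> {..y}"
          using AE_\<nu>_Y by eventually_elim (use 2 in auto)
        then show ?thesis
          using sets_\<nu> by (subst \<nu>.prob_eq_1) auto
      qed
      ultimately show ?thesis unfolding d by (simp add: cdf_def)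
    next
      case 3
      obtain z where z: "z \<in> closure X" "excess z y = 0" using level_exists[OF 3] by blast
      have "measure \<mu> {x. splitting_map x \<le> y} = measure \<mu> {x\<in>X. s z y < s x y}"
      proof (rule \<mu>.finite_measure_eq_AE)
        show "AE x in \<mu>. (x \<in> {x. splitting_map x \<le> y}) = (x \<in> {x\<in>X. s z y < s x y})"
          using AE_\<mu>_X AE_\<mu>_level[OF 3, of "s z y"]
        proof eventually_elim
          case (elim x)
          then show ?case
            using threshold_sign[OF sub_K[OF elim(1)] 3] threshold_eq[OF 3 z] by auto
        qed
      qed (use meas sets_above[OF 3] in auto)
      also have "\<dots> = measure \<nu> {a..<y}" using z(2) by (simp add: excess_def)
      finally show ?thesis unfolding d by (simp add: \<nu>_interval_eq_cdf[OF 3])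
    qed
  qed
qed

definition potential :: "real \<Rightarrow> real" where
  "potential y = integral {a..y} threshold"

lemma potential_deriv:
  "y \<in> {a..b} \<Longrightarrow> (potential has_real_derivative threshold y) (at y within {a..b})"
  unfolding potential_def by (rule integral_has_real_derivative[OF cont_threshold])

lemma cont_potential: "continuous_on {a..b} potential"
  using potential_deriv by (rule DERIV_continuous_on)

text \<open>The derivative of \<open>f - potential\<close> at t is s(x,t) minus the threshold, which
  by \<open>threshold_sign\<close> is negative before the splitting point and positive after
  it.\<close>

lemma potential_gap:
  assumes deriv: "\<And>y. y \<in> {a..b} \<Longrightarrow> (f has_real_derivative s x y) (at y within {a..b})"
    and x: "x \<in> closure X" and y: "y \<in> {a..b}" "y \<noteq> splitting_map x"
  shows "f (splitting_map x) - potential (splitting_map x) < f y - potential y"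
proof -
  let ?g = "\<lambda>t. f t - potential t" and ?m = "splitting_map x"
  have m: "a \<le> ?m" "?m \<le> b" using splitting_map(1)[OF x] by auto
  have d: "(?g has_real_derivative s x t - threshold t) (at t within {a..b})" if "t \<in> {a..b}" for t
    using that by (intro DERIV_diff deriv potential_deriv)
  have cont: "continuous_on {a..b} ?g" using d by (rule DERIV_continuous_on)
  have d': "(?g has_real_derivative s x t - threshold t) (at t)" if "a < t" "t < b" for t
    using d[of t] that by (simp add: at_within_Icc_at)
  consider "?m < y" | "y < ?m" using y(2) by linarith
  then show ?thesis
  proof cases
    case 1
    show ?thesis
    proof (rule DERIV_pos_imp_increasing_open[OF 1])
      show "\<exists>l. (?g has_real_derivative l) (at t) \<and> 0 < l" if "?m < t" "t < y" for t
        using d'[of t] threshold_sign(2)[OF x, of t] that m y(1)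
        by (intro exI[of _ "s x t - threshold t"]) auto
      show "continuous_on {?m..y} ?g" using m y(1) by (intro continuous_on_subset[OF cont]) auto
    qed
  next
    case 2
    show ?thesis
    proof (rule DERIV_neg_imp_decreasing_open[OF 2])
      show "\<exists>l. (?g has_real_derivative l) (at t) \<and> l < 0" if "y < t" "t < ?m" for t
        using d'[of t] threshold_sign(1)[OF x, of t] that m y(1)
        by (intro exI[of _ "s x t - threshold t"]) auto
      show "continuous_on {y..?m} ?g" using m y(1) by (intro continuous_on_subset[OF cont]) auto
    qed
  qed
qed

end

section \<open>Optimality\<close>

lemma set_integrable_cont:
  fixes f :: "'z::euclidean_space \<Rightarrow> real"
  assumes "finite_measure M" "sets M = sets borel" "open S" "compact T" "S \<subseteq> T" "continuous_on T f"
  shows "set_integrable M S f"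
proof -
  interpret finite_measure M by fact
  have "bounded (f ` T)" using assms(4,6) compact_continuous_image compact_imp_bounded by blast
  then obtain B where B: "\<And>x. x \<in> T \<Longrightarrow> \<bar>f x\<bar> \<le> B" unfolding bounded_iff by auto
  have "(\<lambda>x. indicator S x *\<^sub>R f x) \<in> borel_measurable borel"
    using assms(3,5,6) by (intro borel_measurable_continuous_on_indicator continuous_on_subset[OF assms(6)]) auto
  then have m: "(\<lambda>x. indicator S x *\<^sub>R f x) \<in> borel_measurable M"
    using assms(2) by (simp cong: measurable_cong_sets)
  have "norm (indicator S x *\<^sub>R f x) \<le> \<bar>B\<bar>" for x
    using B[of x] assms(5) by (auto simp: indicator_def)
  then show ?thesis
    unfolding set_integrable_def by (intro integrable_const_bound[OF _ m, of "\<bar>B\<bar>"]) auto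
qed

section \<open>Duality for couplings\<close>

locale planar_splitting = anchored_splitting X a b s \<mu> \<nu>
  for X :: "(real^2) set" and a b :: real and s :: "real^2 \<Rightarrow> real \<Rightarrow> real"
    and \<mu> :: "(real^2) measure" and \<nu> :: "real measure" +
  fixes c :: "real^2 \<Rightarrow> real \<Rightarrow> real"
  assumes cont_c: "continuous_on (closure X \<times> {a..b}) (\<lambda>(x, y). c x y)"
    and deriv_c: "\<And>x y. x \<in> closure X \<Longrightarrow> y \<in> {a..b} \<Longrightarrow>
      (c x has_real_derivative s x y) (at y within {a..b})"
begin

interpretation \<mu>: prob_space \<mu> by (rule prob_\<mu>)

text \<open>The c-transform of \<open>potential\<close>: by \<open>potential_gap\<close> this is the
  minimum of c(x,.) - potential over {a..b}.\<close>

definition dual_map :: "real^2 \<Rightarrow> real" where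
  "dual_map x = c x (splitting_map x) - potential (splitting_map x)"

definition dual_value :: real where
  "dual_value = (LINT x:X|\<mu>. dual_map x) + (LINT y:{a<..<b}|\<nu>. potential y)"

lemma cont_dual_map: "continuous_on (closure X) dual_map"
proof -
  have "continuous_on (closure X) (\<lambda>x. (\<lambda>(x, y). c x y) (x, splitting_map x))"
    by (rule continuous_on_compose2[OF cont_c])
      (use splitting_map(1) in \<open>auto intro!: continuous_on_Pair continuous_on_id cont_splitting_map\<close>)
  moreover have "continuous_on (closure X) (\<lambda>x. potential (splitting_map x))"
    using splitting_map(1) by (intro continuous_on_compose2[OF cont_potential cont_splitting_map]) auto
  ultimately have "continuous_on (closure X) (\<lambda>x. (\<lambda>(x, y). c x y) (x, splitting_map x) - potential (splitting_map x))"
    by (rule continuous_on_diff)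
  then show ?thesis by (simp add: dual_map_def[abs_def])
qed

lemma coupling_AE:
  assumes "\<pi> \<in> couplings \<mu> \<nu>"
  shows "AE z in \<pi>. fst z \<in> X" "AE z in \<pi>. snd z \<in> {a<..<b}"
proof -
  have \<pi>: "sets \<pi> = sets borel" "distr \<pi> borel fst = \<mu>" "distr \<pi> borel snd = \<nu>"
    using assms by (auto simp: couplings_def)
  have m: "fst \<in> measurable \<pi> borel" "snd \<in> measurable \<pi> borel"
    unfolding measurable_cong_sets[OF \<pi>(1) refl]
    by (auto intro!: borel_measurable_continuous_onI continuous_on_fst continuous_on_snd continuous_on_id)
  have "AE x in distr \<pi> borel fst. x \<in> X" unfolding \<pi>(2) by (rule AE_\<mu>_X)
  then show "AE z in \<pi>. fst z \<in> X" by (rule AE_distrD[OF m(1)])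
  have "AE y in distr \<pi> borel snd. y \<in> {a<..<b}" unfolding \<pi>(3) by (rule AE_\<nu>_Y)
  then show "AE z in \<pi>. snd z \<in> {a<..<b}" by (rule AE_distrD[OF m(2)])
qed

text \<open>The slack \<open>D\<close> in the dual constraint is nonnegative and vanishes exactly on
  the graph of the splitting map. By the marginal conditions its integral is the cost minus
  \<open>dual_value\<close>, so equality of the two means that \<open>D\<close> vanishes almost
  everywhere.\<close>

lemma coupling_cost:
  assumes cpl: "\<pi> \<in> couplings \<mu> \<nu>"
  shows "dual_value \<le> kantorovich_cost c X a b \<pi>"
    and "kantorovich_cost c X a b \<pi> \<le> dual_value \<Longrightarrow> AE z in \<pi>. snd z = splitting_map (fst z)"
    and "AE z in \<pi>. snd z = splitting_map (fst z) \<Longrightarrow> kantorovich_cost c X a b \<pi> = dual_value"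
proof -
  have \<pi>: "prob_space \<pi>" "sets \<pi> = sets borel" "distr \<pi> borel fst = \<mu>" "distr \<pi> borel snd = \<nu>"
    using cpl by (auto simp: couplings_def)
  interpret \<pi>: prob_space \<pi> by fact
  have mf: "fst \<in> measurable \<pi> borel" "snd \<in> measurable \<pi> borel"
    unfolding measurable_cong_sets[OF \<pi>(2) refl]
    by (auto intro!: borel_measurable_continuous_onI continuous_on_fst continuous_on_snd continuous_on_id)
  \<comment> \<open>The indicators express the set integrals over the whole space, where the
    marginals act as image measures.\<close>
  define C where "C z = indicat_real (X \<times> {a<..<b}) z *\<^sub>R c (fst z) (snd z)" for z
  define W where "W x = indicat_real X x *\<^sub>R dual_map x" for x
  define V where "V y = indicat_real {a<..<b} y *\<^sub>R potential y" for y
  define D where "D z = C z - W (fst z) - V (snd z)" for z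
  have "set_integrable \<pi> (X \<times> {a<..<b}) (\<lambda>z. c (fst z) (snd z))"
  proof (rule set_integrable_cont[OF \<pi>.finite_measure_axioms \<pi>(2)])
    show "open (X \<times> {a<..<b})" using X(1) by (intro open_Times) auto
    show "compact (closure X \<times> {a..b})" using compact_K by (intro compact_Times) auto
    show "X \<times> {a<..<b} \<subseteq> closure X \<times> {a..b}" using closure_subset[of X] by auto
    show "continuous_on (closure X \<times> {a..b}) (\<lambda>z. c (fst z) (snd z))"
      using cont_c by (simp add: case_prod_beta')
  qed
  then have C: "integrable \<pi> C"
    unfolding set_integrable_def C_def[abs_def] .
  have W: "integrable \<mu> W"
    using set_integrable_cont[OF \<mu>.finite_measure_axioms sets_\<mu> X(1) compact_K closure_subset cont_dual_map]
    unfolding set_integrable_def W_def[abs_def] .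
  have "{a<..<b} \<subseteq> {a..b}" by auto
  from set_integrable_cont[OF prob_space.finite_measure[OF prob_\<nu>] sets_\<nu> _ _ this cont_potential]
  have V: "integrable \<nu> V"
    unfolding set_integrable_def V_def[abs_def] by simp
  have mW: "W \<in> borel_measurable borel"
    using borel_measurable_integrable[OF W] unfolding measurable_cong_sets[OF sets_\<mu> refl] .
  have mV: "V \<in> borel_measurable borel"
    using borel_measurable_integrable[OF V] unfolding measurable_cong_sets[OF sets_\<nu> refl] .
  have W': "integrable \<pi> (\<lambda>z. W (fst z))" "(\<integral>z. W (fst z) \<partial>\<pi>) = (\<integral>x. W x \<partial>\<mu>)"
    using W integrable_distr_eq[OF mf(1) mW] integral_distr[OF mf(1) mW] unfolding \<pi>(3) by auto
  have V': "integrable \<pi> (\<lambda>z. V (snd z))" "(\<integral>z. V (snd z) \<partial>\<pi>) = (\<integral>y. V y \<partial>\<nu>)"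
    using V integrable_distr_eq[OF mf(2) mV] integral_distr[OF mf(2) mV] unfolding \<pi>(4) by auto
  have D: "integrable \<pi> D"
    unfolding D_def[abs_def] by (intro Bochner_Integration.integrable_diff C W' V')
  have vals: "kantorovich_cost c X a b \<pi> = (\<integral>z. C z \<partial>\<pi>)"
    "dual_value = (\<integral>x. W x \<partial>\<mu>) + (\<integral>y. V y \<partial>\<nu>)"
    unfolding kantorovich_cost_def dual_value_def set_lebesgue_integral_def C_def W_def V_def by simp_all
  have int_D: "(\<integral>z. D z \<partial>\<pi>) = kantorovich_cost c X a b \<pi> - dual_value"
    unfolding D_def vals
    using Bochner_Integration.integral_diff[OF Bochner_Integration.integrable_diff[OF C W'(1)] V'(1)]
      Bochner_Integration.integral_diff[OF C W'(1)] W'(2) V'(2) by simp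
  have D_alt: "AE z in \<pi>. 0 \<le> D z \<and> (D z = 0 \<longleftrightarrow> snd z = splitting_map (fst z))"
    using coupling_AE[OF cpl]
  proof eventually_elim
    case (elim z)
    have x: "fst z \<in> closure X" and y: "snd z \<in> {a..b}" using elim sub_K by auto
    have Dz: "D z = (c (fst z) (snd z) - potential (snd z)) - dual_map (fst z)"
      using elim by (simp add: D_def C_def W_def V_def indicator_def mem_Times_iff)
    show ?case
    proof (cases "snd z = splitting_map (fst z)")
      case True
      then show ?thesis by (simp add: Dz dual_map_def)
    next
      case False
      have "0 < D z"
        using potential_gap[OF deriv_c[OF x] x y False] by (simp add: Dz dual_map_def)
      then show ?thesis using False by simp
    qed
  qed
  then have D_nonneg: "AE z in \<pi>. 0 \<le> D z" by (rule eventually_mono) simp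
  have "0 \<le> (\<integral>z. D z \<partial>\<pi>)" using D_nonneg by (rule integral_nonneg_AE)
  then show ge: "dual_value \<le> kantorovich_cost c X a b \<pi>" using int_D by simp
  show "AE z in \<pi>. snd z = splitting_map (fst z)" if "kantorovich_cost c X a b \<pi> \<le> dual_value"
  proof -
    have "(\<integral>z. D z \<partial>\<pi>) = 0" using that ge int_D by simp
    then have "AE z in \<pi>. D z = 0" using integral_nonneg_eq_0_iff_AE[OF D D_nonneg] by simp
    with D_alt show ?thesis by eventually_elim simp
  qed
  show "kantorovich_cost c X a b \<pi> = dual_value" if "AE z in \<pi>. snd z = splitting_map (fst z)"
  proof -
    have "AE z in \<pi>. D z = 0" using D_alt that by eventually_elim simp
    then have "(\<integral>z. D z \<partial>\<pi>) = 0" by (rule integral_eq_zero_AE)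
    then show ?thesis using int_D by simp
  qed
qed

text \<open>Carries \<open>coupling_cost\<close> over from couplings to maps.\<close>

lemma graph_coupling:
  assumes G: "G \<in> borel_measurable borel" and push: "distr \<mu> borel G = \<nu>"
    and GY: "\<And>x. x \<in> X \<Longrightarrow> G x \<in> {a<..<b}"
  defines "\<pi> \<equiv> distr \<mu> borel (\<lambda>x. (x, G x))"
  shows "\<pi> \<in> couplings \<mu> \<nu>" "kantorovich_cost c X a b \<pi> = (LINT x:X|\<mu>. c x (G x))"
    "(AE z in \<pi>. snd z = splitting_map (fst z)) \<longleftrightarrow> (AE x in \<mu>. G x = splitting_map x)"
proof -
  have G': "G \<in> measurable \<mu> borel"
    using G unfolding measurable_cong_sets[OF sets_\<mu> refl] .
  have id: "(\<lambda>x. x) \<in> measurable \<mu> borel"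
    unfolding measurable_cong_sets[OF sets_\<mu> refl] by simp
  have m: "(\<lambda>x. (x, G x)) \<in> measurable \<mu> borel" using id G' by (rule borel_measurable_Pair)
  have fs: "(fst :: (real^2) \<times> real \<Rightarrow> _) \<in> measurable borel borel"
    "(snd :: (real^2) \<times> real \<Rightarrow> _) \<in> measurable borel borel"
    by (auto intro!: borel_measurable_continuous_onI continuous_on_fst continuous_on_snd continuous_on_id)
  have "distr \<pi> borel fst = distr \<mu> borel (\<lambda>x. x)"
    unfolding \<pi>_def by (subst distr_distr[OF fs(1) m]) (simp add: comp_def)
  also have "\<dots> = \<mu>" using sets_\<mu> by (intro distr_id2) simp
  finally have 1: "distr \<pi> borel fst = \<mu>" .
  have "distr \<pi> borel snd = \<nu>"
    unfolding \<pi>_def push[symmetric] by (subst distr_distr[OF fs(2) m]) (simp add: comp_def)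
  then show cpl: "\<pi> \<in> couplings \<mu> \<nu>"
    using 1 \<mu>.prob_space_distr[OF m] by (simp add: couplings_def \<pi>_def)
  have "continuous_on (X \<times> {a<..<b}) (\<lambda>z. c (fst z) (snd z))"
    using closure_subset[of X]
    by (intro continuous_on_subset[OF cont_c, unfolded case_prod_beta'] Sigma_mono) auto
  then have mc: "(\<lambda>z. indicat_real (X \<times> {a<..<b}) z *\<^sub>R c (fst z) (snd z)) \<in> borel_measurable borel"
    using X(1) by (intro borel_measurable_continuous_on_indicator borel_open open_Times) auto
  have "kantorovich_cost c X a b \<pi> = (\<integral>x. indicat_real (X \<times> {a<..<b}) (x, G x) *\<^sub>R c x (G x) \<partial>\<mu>)"
    unfolding kantorovich_cost_def set_lebesgue_integral_def \<pi>_def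
    by (subst integral_distr[OF m mc]) simp
  also have "\<dots> = (LINT x:X|\<mu>. c x (G x))"
    unfolding set_lebesgue_integral_def
    using GY by (intro Bochner_Integration.integral_cong refl) (auto simp: indicator_def)
  finally show "kantorovich_cost c X a b \<pi> = (LINT x:X|\<mu>. c x (G x))" .
  have "(\<lambda>z. splitting_map (fst z)) \<in> borel_measurable (borel :: ((real^2) \<times> real) measure)"
    using measurable_compose[OF fs(1) measurable_splitting_map] .
  then have "{z \<in> space borel. snd z = splitting_map (fst z)} \<in> sets (borel :: ((real^2) \<times> real) measure)"
    using fs(2) by (intro borel_measurable_eq) auto
  then show "(AE z in \<pi>. snd z = splitting_map (fst z)) \<longleftrightarrow> (AE x in \<mu>. G x = splitting_map x)"
    unfolding \<pi>_def by (subst AE_distr_iff[OF m]) auto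
qed

end

section \<open>Optimal maps and the support of an optimal coupling\<close>

context planar_splitting
begin

interpretation \<mu>: prob_space \<mu> by (rule prob_\<mu>)

lemma distr_restrict_X:
  assumes G: "G \<in> borel_measurable borel"
  shows "distr (restrict_space \<mu> X) borel G = distr \<mu> borel G"
proof (rule measure_eqI)
  have G': "G \<in> measurable \<mu> borel"
    using G unfolding measurable_cong_sets[OF sets_\<mu> refl] .
  have sp: "space \<mu> = UNIV" using sets_eq_imp_space_eq[OF sets_\<mu>] by simp
  have Xs: "X \<in> sets \<mu>" using X(1) sets_\<mu> by simp
  fix A assume "A \<in> sets (distr (restrict_space \<mu> X) borel G)"
  then have A: "A \<in> sets borel" by simp
  then have GA: "G -` A \<in> sets \<mu>" using measurable_sets[OF G'] sp by fastforce
  have "emeasure (distr (restrict_space \<mu> X) borel G) A = emeasure (restrict_space \<mu> X) (G -` A \<inter> X)"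
    using A measurable_restrict_space1[OF G'] sp by (simp add: emeasure_distr space_restrict_space)
  also have "\<dots> = emeasure \<mu> (G -` A \<inter> X)"
    using Xs by (intro emeasure_restrict_space) auto
  also have "\<dots> = emeasure \<mu> (G -` A)"
    using AE_\<mu>_X GA Xs by (intro emeasure_eq_AE) auto
  also have "\<dots> = emeasure (distr \<mu> borel G) A"
    using A G' sp by (simp add: emeasure_distr)
  finally show "emeasure (distr (restrict_space \<mu> X) borel G) A = emeasure (distr \<mu> borel G) A" .
qed simp

text \<open>A transport map is measurable only on \<open>X\<close>; the constant extension is Borel
  and alters nothing \<mu>-almost everywhere.\<close>

lemma transport_map_extend:
  assumes "transport_map X a b \<mu> \<nu> G"
  defines "G' \<equiv> \<lambda>x. if x \<in> X then G x else a"
  shows "G' \<in> borel_measurable borel" "distr \<mu> borel G' = \<nu>" "\<And>x. x \<in> X \<Longrightarrow> G' x \<in> {a<..<b}"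
proof -
  have G: "G \<in> borel_measurable (restrict_space borel X)" "G ` X \<subseteq> {a<..<b}"
    "distr (restrict_space \<mu> X) borel G = \<nu>"
    using assms(1) by (auto simp: transport_map_def)
  show G': "G' \<in> borel_measurable borel"
    using G(1) X(1) measurable_restrict_space_iff[of X borel a borel G] by (simp add: G'_def)
  have "distr \<mu> borel G' = distr (restrict_space \<mu> X) borel G'"
    using distr_restrict_X[OF G'] by simp
  also have "\<dots> = distr (restrict_space \<mu> X) borel G"
    by (intro distr_cong) (auto simp: G'_def space_restrict_space)
  finally show "distr \<mu> borel G' = \<nu>" using G(3) by simp
  show "G' x \<in> {a<..<b}" if "x \<in> X" for x using G(2) that by (auto simp: G'_def)
qed

lemma splitting_map_in_Y: "x \<in> X \<Longrightarrow> splitting_map x \<in> {a<..<b}"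
  using splitting_map_interior by simp

lemma transport_map_splitting_map: "transport_map X a b \<mu> \<nu> splitting_map"
  unfolding transport_map_def
  using splitting_map_in_Y distr_restrict_X[OF measurable_splitting_map] distr_splitting_map
  by (auto intro: measurable_restrict_space1[OF measurable_splitting_map])

lemma set_integral_splitting_map: "(LINT x:X|\<mu>. c x (splitting_map x)) = dual_value"
proof -
  note g = graph_coupling[OF measurable_splitting_map distr_splitting_map splitting_map_in_Y]
  show ?thesis using coupling_cost(3)[OF g(1)] g(2,3) by simp
qed

lemma transport_map_cost:
  assumes G: "transport_map X a b \<mu> \<nu> G"
  shows "dual_value \<le> (LINT x:X|\<mu>. c x (G x))"
    and "(LINT x:X|\<mu>. c x (G x)) \<le> dual_value \<Longrightarrow> AE x in \<mu>. G x = splitting_map x"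
proof -
  let ?G = "\<lambda>x. if x \<in> X then G x else a"
  note g = graph_coupling[OF transport_map_extend[OF G]]
  have eq: "(LINT x:X|\<mu>. c x (?G x)) = (LINT x:X|\<mu>. c x (G x))"
    unfolding set_lebesgue_integral_def
    by (intro Bochner_Integration.integral_cong refl) (simp add: indicator_def)
  show "dual_value \<le> (LINT x:X|\<mu>. c x (G x))"
    using coupling_cost(1)[OF g(1)] g(2) eq by simp
  show "AE x in \<mu>. G x = splitting_map x" if "(LINT x:X|\<mu>. c x (G x)) \<le> dual_value"
  proof -
    have "AE x in \<mu>. ?G x = splitting_map x"
      using coupling_cost(2)[OF g(1)] g(2,3) eq that by simp
    with AE_\<mu>_X show ?thesis by eventually_elim simp
  qed
qed

lemma optimal_map_splitting_map: "optimal_map c X a b \<mu> \<nu> splitting_map"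
  unfolding optimal_map_def
  using transport_map_splitting_map transport_map_cost(1) set_integral_splitting_map by simp

lemma optimal_map_unique:
  assumes "optimal_map c X a b \<mu> \<nu> G"
  shows "AE x in \<mu>. G x = splitting_map x"
  using assms transport_map_cost(2)[of G] transport_map_splitting_map set_integral_splitting_map
  unfolding optimal_map_def by auto

lemma kantorovich_solution_AE:
  assumes "kantorovich_solution c X a b \<mu> \<nu> \<pi>"
  shows "\<pi> \<in> couplings \<mu> \<nu>" "AE z in \<pi>. snd z = splitting_map (fst z)"
proof -
  note g = graph_coupling[OF measurable_splitting_map distr_splitting_map splitting_map_in_Y]
  show \<pi>: "\<pi> \<in> couplings \<mu> \<nu>" using assms by (simp add: kantorovich_solution_def)
  \<comment> \<open>The competitor is the graph coupling of the splitting map, whose cost is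
    \<open>dual_value\<close>.\<close>
  have "kantorovich_cost c X a b \<pi> \<le> dual_value"
    using assms g(1,2) set_integral_splitting_map by (auto simp: kantorovich_solution_def)
  then show "AE z in \<pi>. snd z = splitting_map (fst z)" by (rule coupling_cost(2)[OF \<pi>])
qed

text \<open>The graph over the closure is closed and carries all mass, so it contains the support
  over x. Conversely, if a closed set of full mass missed a graph point, continuity would give a
  neighbourhood of x whose part of the graph is missed too; this neighbourhood meets
  \<open>X\<close> and has positive mass.\<close>

lemma spt_graph:
  assumes \<pi>: "\<pi> \<in> couplings \<mu> \<nu>" "AE z in \<pi>. snd z = splitting_map (fst z)"
    and x: "x \<in> closure X"
  shows "(x, y) \<in> spt \<pi> \<longleftrightarrow> y = splitting_map x"
proof -
  have \<pi>': "sets \<pi> = sets borel" "distr \<pi> borel fst = \<mu>"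
    using \<pi>(1) by (auto simp: couplings_def)
  have sp: "space \<pi> = UNIV" using sets_eq_imp_space_eq[OF \<pi>'(1)] by simp
  have m: "fst \<in> measurable \<pi> borel"
    unfolding measurable_cong_sets[OF \<pi>'(1) refl]
    by (auto intro!: borel_measurable_continuous_onI continuous_on_fst continuous_on_id)
  show ?thesis
  proof
    let ?K = "(\<lambda>x. (x, splitting_map x)) ` closure X"
    assume xy: "(x, y) \<in> spt \<pi>"
    have "closed ?K" using compact_zero_set by (simp add: graph_eq_zero_set compact_imp_closed)
    moreover have "emeasure \<pi> (- ?K) = 0"
    proof -
      have "AE z in \<pi>. z \<in> ?K"
        using \<pi>(2) coupling_AE(1)[OF \<pi>(1)]
      proof eventually_elim
        case (elim z)
        then have "z = (fst z, splitting_map (fst z))" by (simp add: prod_eq_iff)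
        then show ?case using elim(2) sub_K by blast
      qed
      then have "{z \<in> space \<pi>. z \<notin> ?K} \<in> null_sets \<pi>"
        using \<open>closed ?K\<close> \<pi>'(1) by (intro AE_iff_null[THEN iffD1]) (auto simp: sp Compl_eq[symmetric])
      then show ?thesis by (simp add: sp Compl_eq[symmetric] null_setsD1)
    qed
    ultimately have "(x, y) \<in> ?K" using xy unfolding spt_def by blast
    then show "y = splitting_map x" by auto
  next
    have m: "fst \<in> measurable \<pi> borel"
      unfolding measurable_cong_sets[OF \<pi>'(1) refl]
      by (auto intro!: borel_measurable_continuous_onI continuous_on_fst continuous_on_id)
    assume y: "y = splitting_map x"
    show "(x, y) \<in> spt \<pi>"
      unfolding spt_def
    proof (rule InterI, rule ccontr)
      fix C :: "((real^2) \<times> real) set"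
      assume C: "C \<in> {C. closed C \<and> emeasure \<pi> (- C) = 0}" and nC: "(x, y) \<notin> C"
      then have openC: "open (- C)" and nullC: "emeasure \<pi> (- C) = 0" by auto
      have cont: "continuous_on (closure X) (\<lambda>x. (x, splitting_map x))"
        by (intro continuous_on_Pair continuous_on_id cont_splitting_map)
      obtain U where U: "open U" "U \<inter> closure X = (\<lambda>x. (x, splitting_map x)) -` (- C) \<inter> closure X"
        using cont openC unfolding continuous_on_open_invariant by blast
      have "x \<in> U" using U(2) x nC y by blast
      then have "U \<inter> X \<noteq> {}" using x U(1) open_Int_closure_eq_empty by blast
      then have pos: "0 < measure \<mu> U" by (rule \<mu>_pos[OF U(1)])
      have "emeasure \<mu> U = emeasure \<pi> (fst -` U)"
        unfolding \<pi>'(2)[symmetric] using U(1) m sp by (simp add: emeasure_distr)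
      also have "\<dots> \<le> emeasure \<pi> (- C)"
      proof (rule emeasure_mono_AE)
        show "AE z in \<pi>. z \<in> fst -` U \<longrightarrow> z \<in> - C"
          using \<pi>(2) coupling_AE(1)[OF \<pi>(1)]
        proof eventually_elim
          case (elim z)
          show ?case
          proof
            assume "z \<in> fst -` U"
            then have "fst z \<in> U \<inter> closure X" using elim(2) sub_K by auto
            then have "(fst z, splitting_map (fst z)) \<in> - C" using U(2) by blast
            then show "z \<in> - C" using elim(1) by (metis prod.collapse)
          qed
        qed
        show "- C \<in> sets \<pi>" using openC \<pi>'(1) by simp
      qed
      finally show False using pos nullC by (simp add: \<mu>.emeasure_eq_measure)
    qed
  qed
qed

end

lemma spt_measure_pos:
  assumes "sets M = sets borel" "open U" "U \<inter> spt M \<noteq> {}" "finite_measure M"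
  shows "0 < measure M U"
proof (rule ccontr)
  interpret finite_measure M by fact
  assume "\<not> 0 < measure M U"
  then have "emeasure M (- (- U)) = 0"
    using measure_nonneg[of M U] by (simp add: emeasure_eq_measure)
  then have "spt M \<subseteq> - U" unfolding spt_def using assms(2) by (intro Inter_lower) auto
  then show False using assms(3) by blast
qed

text \<open>Optimal maps are determined only almost everywhere. That one is well defined everywhere
  is expressed by an optimal F whose value at each point of the closure is the only support point
  above it.\<close>

theorem theorem4p8:
  fixes X :: "(real^2) set" and a b :: real
    and c :: "real^2 \<Rightarrow> real \<Rightarrow> real"
    and \<mu> :: "(real^2) measure" and \<nu> :: "real measure"
    and \<gamma> :: "((real^2) \<times> real) measure"
  assumes X: "open X" "connected X" "X \<noteq> {}" "bounded X"
    and Y: "a < b"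
    and C2: "C2_up_to_closure (\<lambda>(x, y). c x y) (X \<times> {a<..<b})"
    and nondegenerate: "\<forall>x\<in>X. \<forall>y\<in>{a..b}. \<exists>D. (GDERIV (\<lambda>x'. cost_dy c a b x' y) x :> D) \<and> D \<noteq> 0"
    and \<mu>: "borel_prob_on X \<mu>" "absolutely_continuous lborel \<mu>" "spt \<mu> = closure X"
    and \<nu>: "borel_prob_on {a<..<b} \<nu>" "absolutely_continuous lborel \<nu>"
    and \<gamma>: "kantorovich_solution c X a b \<mu> \<nu> \<gamma>"
    and MCP: "\<forall>x\<in>closure X. \<forall>y\<in>{a..b}. splits_mass c X a b \<mu> \<nu> x y \<longrightarrow>
      (\<exists>x'\<in>set_P c X a b \<inter> level_set c X a b x y. mass_comparison c X a b \<mu> \<nu> x')"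
  shows "(\<forall>x\<in>closure X. \<exists>!y. y \<in> {a..b} \<and> splits_mass c X a b \<mu> \<nu> x y) \<and>
    (\<forall>x\<in>closure X. \<forall>y\<in>{a..b}. splits_mass c X a b \<mu> \<nu> x y \<longrightarrow>
       (x, y) \<in> spt \<gamma> \<and> (\<forall>y'\<in>{a..b}. y' \<noteq> y \<longrightarrow> (x, y') \<notin> spt \<gamma>)) \<and>
    (\<exists>F. optimal_map c X a b \<mu> \<nu> F \<and>
       (\<forall>x\<in>closure X. F x \<in> {a..b} \<and> (\<forall>y\<in>{a..b}. (x, y) \<in> spt \<gamma> \<longleftrightarrow> y = F x)) \<and>
       (\<forall>G. optimal_map c X a b \<mu> \<nu> G \<longrightarrow> (AE x in \<mu>. G x = F x)))"
proof -
  let ?s = "cost_dy c a b"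
  have \<mu>': "prob_space \<mu>" "sets \<mu> = sets borel" "emeasure \<mu> X = 1"
    and \<nu>': "prob_space \<nu>" "sets \<nu> = sets borel" "emeasure \<nu> {a<..<b} = 1"
    using \<mu>(1) \<nu>(1) by (auto simp: borel_prob_on_def)
  interpret \<mu>: prob_space \<mu> by (rule \<mu>')
  interpret \<nu>: prob_space \<nu> by (rule \<nu>')
  interpret M: mass_splitting X a b ?s \<mu> \<nu>
  proof
    show "continuous_on (closure X \<times> {a..b}) (\<lambda>(x, y). ?s x y)" by (rule C2_cost_dy(2)[OF Y C2])
    show "measure \<mu> X = 1" "measure \<nu> {a<..<b} = 1" using \<mu>'(3) \<nu>'(3) by (simp_all add: measure_def)
    \<comment> \<open>Full support of \<mu> enters here; through
      \<open>excess_strict_antimono\<close> it lets the excess separate levels.\<close>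
    show "0 < measure \<mu> U" if "open U" "U \<inter> X \<noteq> {}" for U
      using that closure_subset[of X] \<mu>(3)
      by (intro spt_measure_pos[OF \<mu>'(2)]) (auto intro: \<mu>.finite_measure_axioms)
    show "measure \<mu> {x\<in>X. ?s x y = t} = 0" if y: "y \<in> {a..b}" for y t
    proof -
      have "{x\<in>X. ?s x y = t} \<in> null_sets lborel"
        using nondegenerate y by (intro level_set_null X) auto
      then have "{x\<in>X. ?s x y = t} \<in> null_sets \<mu>"
        using \<mu>(2) unfolding absolutely_continuous_def by blast
      then show ?thesis by (auto simp: measure_def)
    qed
    show "\<exists>z\<in>X. ?s x y < ?s z y" "\<exists>z\<in>X. ?s z y < ?s x y" if xy: "x \<in> X" "y \<in> {a..b}" for x y
    proof -
      obtain D where "GDERIV (\<lambda>x'. ?s x' y) x :> D" "D \<noteq> 0"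
        using nondegenerate xy by blast
      from gderiv_nonzero_not_extremal[OF X(1) xy(1) this]
      show "\<exists>z\<in>X. ?s x y < ?s z y" "\<exists>z\<in>X. ?s z y < ?s x y" .
    qed
    show "measure \<nu> {y} = 0" for y
    proof -
      have "{y} \<in> null_sets lborel" by (rule finite_imp_null_set_lborel) simp
      then have "{y} \<in> null_sets \<nu>"
        using \<nu>(2) unfolding absolutely_continuous_def by blast
      then show ?thesis by (auto simp: measure_def)
    qed
  qed (use X Y \<mu>' \<nu>' in auto)
  have splits: "splits_mass c X a b \<mu> \<nu> x y \<longleftrightarrow> M.excess x y = 0" for x y
    by (simp add: splits_mass_def M.excess_def)
  interpret planar_splitting X a b ?s \<mu> \<nu> c
  proof unfold_locales
    show "\<exists>p\<in>closure X. ?s p y = ?s x y \<and> M.crosses_upward p \<and> M.sweeps_less p"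
      if x: "x \<in> closure X" and y: "y \<in> {a..b}" and zero: "M.excess x y = 0" for x y
    proof -
      have "splits_mass c X a b \<mu> \<nu> x y" using zero splits by simp
      then obtain p where p: "p \<in> set_P c X a b" "p \<in> level_set c X a b x y"
        "mass_comparison c X a b \<mu> \<nu> p"
        using MCP x y by blast
      have "M.crosses_upward p"
        using p(1) unfolding set_P_def M.crosses_upward_def level_set_def by blast
      moreover have "M.sweeps_less p"
        using p(3) unfolding mass_comparison_def M.sweeps_less_def level_set_def .
      ultimately show ?thesis using p(2) by (auto simp: level_set_def)
    qed
    show "continuous_on (closure X \<times> {a..b}) (\<lambda>(x, y). c x y)" by (rule C2_cost_dy(1)[OF Y C2])
    show "(c x has_real_derivative ?s x y) (at y within {a..b})"
      if "x \<in> closure X" "y \<in> {a..b}" for x y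
      using C2_cost_dy(3)[OF Y C2 that] .
  qed
  note spt = spt_graph[OF kantorovich_solution_AE[OF \<gamma>]]
  show ?thesis
  proof (intro conjI exI[of _ splitting_map] ballI allI impI)
    show "\<exists>!y. y \<in> {a..b} \<and> splits_mass c X a b \<mu> \<nu> x y" if "x \<in> closure X" for x
      using ex1_zero[OF that] by (simp add: splits)
    show "(x, y) \<in> spt \<gamma>" if "x \<in> closure X" "y \<in> {a..b}" "splits_mass c X a b \<mu> \<nu> x y" for x y
      using spt[OF that(1)] splitting_map(3)[OF that(1,2)] that(3) by (simp add: splits)
    show "(x, y') \<notin> spt \<gamma>" if "x \<in> closure X" "y \<in> {a..b}" "splits_mass c X a b \<mu> \<nu> x y" "y' \<noteq> y"
      for x y y'
      using spt[OF that(1)] splitting_map(3)[OF that(1,2)] that(3,4) by (simp add: splits)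
  qed (use spt splitting_map(1) optimal_map_splitting_map optimal_map_unique in auto)
qed

end
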